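(* Let $M,N>2$, $\rho_1,\rho_2>0$ and $k_1,k_2$ be integers such that $\tan\frac{k_1\pi}{\rho_1M}$ and $\tan\frac{k_2\pi}{\rho_2N}$ are defined and nonzero, and suppose that there are nonzero real numbers $p,q$ with $$p^2=\frac{1-\cot^2\frac{\pi}{M}\tan^2\frac{k_1\pi}{\rho_1M}}{\cot^2\frac{\pi}{N}\tan^2\frac{k_2\pi}{\rho_2N}-\cot^2\frac{\pi}{M}\tan^2\frac{k_1\pi}{\rho_1M}},\qquad q^2=\frac{1-\cot^2\frac{\pi}{N}\tan^2\frac{k_2\pi}{\rho_2N}}{\cot^2\frac{\pi}{M}\tan^2\frac{k_1\pi}{\rho_1M}-\cot^2\frac{\pi}{N}\tan^2\frac{k_2\pi}{\rho_2N}}$$ (so $p^2+q^2=1$). Let $f_{m,n}=q\,e^{\frac{2\pi\mathbf{i}}{N}n}+\mathbf{j}\,p\,e^{\frac{2\pi\mathbf{i}}{M}m}$, $(m,n)\in\mathbb{Z}^2$, be the discrete homogeneous torus in $\mathbb{S}^3\subset\mathbb{H}$, with cross-ratios factorising function $\mu$ given by $$\frac1{\mu_{(m,n),(m+1,n)}}=p^2\bigl|1-e^{\frac{2\pi\mathbf{i}}{M}}\bigr|^2,\qquad \frac1{\mu_{(m,n),(m,n+1)}}=-q^2\bigl|1-e^{\frac{2\pi\mathbf{i}}{N}}\bigr|^2,$$ and let $$\nu=\frac14\Bigl(\cot^2\frac{\pi}{N}\tan^2\frac{k_2\pi}{\rho_2N}-\cot^2\frac{\pi}{M}\tan^2\frac{k_1\pi}{\rho_1M}\Bigr).$$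 (1) Every Darboux transform $\hat f$ of $f$ with spectral parameter $\nu$ is a discrete isothermic torus: $\hat f_{m+\rho_1M,n}=\hat f_{m,n}=\hat f_{m,n+\rho_2N}$ for all $(m,n)\in\mathbb{Z}^2$. (2) These Darboux transforms are given explicitly as follows. For $c^\pm\in\mathbb{H}$ set $$\alpha_m=e^{-\frac{k_1\pi\mathbf{i}}{\rho_1M}m}c^++e^{\frac{k_1\pi\mathbf{i}}{\rho_1M}m}c^-,\qquad \beta_m=\mathbf{j}\Bigl(e^{-\frac{k_1\pi\mathbf{i}}{\rho_1M}m}\sin\tfrac{(\rho_1+k_1)\pi}{\rho_1M}\,c^++e^{\frac{k_1\pi\mathbf{i}}{\rho_1M}m}\sin\tfrac{(\rho_1-k_1)\pi}{\rho_1M}\,c^-\Bigr),$$ $$\tilde\gamma^\pm_m=\sin\tfrac{(\rho_2\mp k_2)\pi}{\rho_2N}\,\alpha_m+\tfrac qp\,\sin\tfrac{\pi}{N}\cos\tfrac{k_2\pi}{\rho_2N}\csc\tfrac{\pi}{M}\sec\tfrac{k_1\pi}{\rho_1M}\,\beta_m,$$ $$U_{m,n}=e^{\frac{k_2\pi\mathbf{i}}{\rho_2N}n}\tilde\gamma^+_m-e^{-\frac{k_2\pi\mathbf{i}}{\rho_2N}n}\tilde\gamma^-_m,\qquad V_{m,n}=e^{\frac{k_2\pi\mathbf{i}}{\rho_2N}n}\sin\tfrac{(\rho_2+k_2)\pi}{\rho_2N}\,\tilde\gamma^+_m-e^{-\frac{k_2\pi\mathbf{i}}{\rho_2N}n}\sin\tfrac{(\rho_2-k_2)\pi}{\rho_2N}\,\tilde\gamma^-_m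 .$$ Then the Darboux transforms of $f$ with spectral parameter $\nu$ are exactly the surfaces $$\hat f_{m,n}=f_{m,n}-2q\,\sin\tfrac{\pi}{N}\cos\tfrac{k_2\pi}{\rho_2N}\;e^{-\frac{\pi\mathbf{i}}{M}m}e^{\frac{\pi\mathbf{i}}{N}n}\;U_{m,n}\,V_{m,n}^{-1}\;e^{\frac{\pi\mathbf{i}}{M}m}e^{\frac{\pi\mathbf{i}}{N}n}$$ with $c^\pm\in\mathbb{H}$ such that $U_{m,n}\neq0$ and $V_{m,n}\neq0$ for all $(m,n)$. (3) If moreover $\hat f_{m_0,n_0}\in\mathbb{S}^3$ for some $(m_0,n_0)$, then $\hat f$ is a discrete isothermic torus in $\mathbb{S}^3$.
   Context: $\mathbb{H}\cong\mathbb{R}^4$ denotes the quaternions with basis $1,\mathbf{i},\mathbf{j},\mathbf{k}$; $\mathbb{S}^3\subset\mathbb{H}$ is the set of unit quaternions. Vertices of an elementary quadrilateral: $i=(m,n)$, $j=(m+1,n)$, $k=(m+1,n+1)$, $\ell=(m,n+1)$. The cross-ratio is $\mathrm{cr}(a,b,c,d)=(a-b)(b-c)^{-1}(c-d)(d-a)^{-1}$. A discrete surface $f$ is discrete isothermic with cross-ratios factorising function $\mu$ (a nowhere-zero real function on unoriented edges with $\mu_{ij}=\mu_{k\ell}$, $\mu_{i\ell}=\mu_{jk}$) if $\mathrm{cr}(f_i,f_j,f_k,f_\ell)=\mu_{i\ell}/\mu_{ij}$ on every elementary quadrilateral. A Darboux transform of $f$ with real spectral parameter $\nu$ is an $\mathbb{H}$-valued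 discrete surface $\hat f$ with $\mathrm{cr}(f_i,f_j,\hat f_j,\hat f_i)=\nu/\mu_{ij}$ on every edge $(ij)$ of either direction (in particular $\hat f_i\neq f_i$ for all $i$); it is then discrete isothermic with the same $\mu$. *)

theory Defs
  imports "HOL-Analysis.Analysis"
begin

section \<open>Quaternions\<close>

datatype quat = Quat (qre: real) (qi: real) (qj: real) (qk: real)

lemma quat_eq_iff: "x = y \<longleftrightarrow> qre x = qre y \<and> qi x = qi y \<and> qj x = qj y \<and> qk x = qk y"
  by (cases x; cases y) simp

instantiation quat :: real_vector
begin

definition "0 = Quat 0 0 0 0"
definition "x + y = Quat (qre x + qre y) (qi x + qi y) (qj x + qj y) (qk x + qk y)"
definition "- x = Quat (- qre x) (- qi x) (- qj x) (- qk x)"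
definition "x - y = Quat (qre x - qre y) (qi x - qi y) (qj x - qj y) (qk x - qk y)"
definition "r *\<^sub>R x = Quat (r * qre x) (r * qi x) (r * qj x) (r * qk x)"

instance
  by standard
    (simp_all add: quat_eq_iff zero_quat_def plus_quat_def uminus_quat_def minus_quat_def
      scaleR_quat_def algebra_simps)

end

instantiation quat :: real_inner
begin

definition "inner x y = qre x * qre y + qi x * qi y + qj x * qj y + qk x * qk y" for x y :: quat
definition "norm x = sqrt (inner x x)" for x :: quat
definition "sgn x = x /\<^sub>R norm x" for x :: quat
definition "dist x y = norm (x - y)" for x y :: quat
definition "(uniformity :: (quat \<times> quat) filter) = (INF e\<in>{0 <..}. principal {(x, y). dist x y < e})"
definition "open U \<longleftrightarrow> (\<forall>x\<in>U. \<forall>\<^sub>F (x', y) in uniformity. x' = x \<longrightarrow> y \<in> U)" for U :: "quat set"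

instance
proof
  fix x y z :: quat and r :: real
  show "inner x x = 0 \<longleftrightarrow> x = 0"
    by (simp add: inner_quat_def quat_eq_iff zero_quat_def add_nonneg_eq_0_iff)
qed (simp_all add: inner_quat_def norm_quat_def sgn_quat_def dist_quat_def uniformity_quat_def
      open_quat_def plus_quat_def scaleR_quat_def algebra_simps)

end

instantiation quat :: real_normed_div_algebra
begin

definition "1 = Quat 1 0 0 0"
definition "x * y = Quat
  (qre x * qre y - qi x * qi y - qj x * qj y - qk x * qk y)
  (qre x * qi y + qi x * qre y + qj x * qk y - qk x * qj y)
  (qre x * qj y - qi x * qk y + qj x * qre y + qk x * qi y)
  (qre x * qk y + qi x * qj y - qj x * qi y + qk x * qre y)"
definition "inverse x = Quat (qre x) (- qi x) (- qj x) (- qk x) /\<^sub>R (norm x)\<^sup>2"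
definition "x div y = x * inverse y" for x y :: quat

instance
proof
  fix x y z :: quat and r :: real
  have n2: "(norm x)\<^sup>2 = qre x * qre x + qi x * qi x + qj x * qj x + qk x * qk x" for x :: quat
    by (simp add: norm_quat_def inner_quat_def)
  show "x * y * z = x * (y * z)" "(x + y) * z = x * z + y * z" "x * (y + z) = x * y + x * z"
    "1 * x = x" "x * 1 = x" "(0 :: quat) \<noteq> 1"
    "r *\<^sub>R x * y = r *\<^sub>R (x * y)" "x * r *\<^sub>R y = r *\<^sub>R (x * y)"
    by (simp_all add: quat_eq_iff times_quat_def one_quat_def plus_quat_def zero_quat_def
        scaleR_quat_def algebra_simps)
  show "x div y = x * inverse y" by (simp add: divide_quat_def)
  show "inverse (0 :: quat) = 0"
    by (simp add: inverse_quat_def zero_quat_def scaleR_quat_def)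
  show "inverse x * x = 1" "x * inverse x = 1" if "x \<noteq> 0"
  proof -
    have "(norm x)\<^sup>2 \<noteq> 0" using that by simp
    then have "(qre x * qre x + qi x * qi x + qj x * qj x + qk x * qk x) / (norm x)\<^sup>2 = 1"
      by (simp add: n2)
    then show "inverse x * x = 1" "x * inverse x = 1"
      by (simp_all add: inverse_quat_def quat_eq_iff times_quat_def one_quat_def scaleR_quat_def
          divide_simps mult_ac split: if_splits)
  qed
  have "(norm (x * y))\<^sup>2 = (norm x * norm y)\<^sup>2"
    unfolding power_mult_distrib n2 by (simp add: times_quat_def algebra_simps)
  then show "norm (x * y) = norm x * norm y"
    by simp
qed

end

definition quat_j :: quat
  where "quat_j = Quat 0 0 1 0"

text \<open>The embedding of the complex numbers as the span of 1 and i.\<close>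

definition quat_of_complex :: "complex \<Rightarrow> quat"
  where "quat_of_complex z = Quat (Re z) (Im z) 0 0"

text \<open>\<open>expi t\<close> is the unit quaternion \<open>e\<^bsup>t i\<^esup>\<close>.\<close>

definition expi :: "real \<Rightarrow> quat"
  where "expi t = quat_of_complex (exp (\<i> * of_real t))"


section \<open>Discrete isothermic surfaces and Darboux transforms\<close>

type_synonym vertex = "int \<times> int"

definition cross_ratio :: "quat \<Rightarrow> quat \<Rightarrow> quat \<Rightarrow> quat \<Rightarrow> quat"
  where "cross_ratio a b c d = (a - b) * inverse (b - c) * (c - d) * inverse (d - a)"

text \<open>A function on unoriented edges is a function of the two-element set of end points; its
  values on sets that are not edges are irrelevant.\<close>

definition factorising_function :: "(vertex set \<Rightarrow> real) \<Rightarrow> bool"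
  where "factorising_function \<mu> \<longleftrightarrow>
    (\<forall>m n. \<mu> {(m, n), (m + 1, n)} \<noteq> 0 \<and> \<mu> {(m, n), (m, n + 1)} \<noteq> 0 \<and>
       \<mu> {(m, n), (m + 1, n)} = \<mu> {(m + 1, n + 1), (m, n + 1)} \<and>
       \<mu> {(m, n), (m, n + 1)} = \<mu> {(m + 1, n), (m + 1, n + 1)})"

text \<open>As \<open>\<mu>\<close> has no zeros and \<open>inverse 0 = 0\<close>, the cross-ratio condition forces the end points
  of every edge to be distinct, so that the cross-ratios are genuinely defined.\<close>

definition discrete_isothermic :: "(vertex set \<Rightarrow> real) \<Rightarrow> (vertex \<Rightarrow> quat) \<Rightarrow> bool"
  where "discrete_isothermic \<mu> f \<longleftrightarrow> factorising_function \<mu> \<and>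
    (\<forall>m n. cross_ratio (f (m, n)) (f (m + 1, n)) (f (m + 1, n + 1)) (f (m, n + 1)) =
       of_real (\<mu> {(m, n), (m, n + 1)} / \<mu> {(m, n), (m + 1, n)}))"

definition darboux_transform ::
    "(vertex set \<Rightarrow> real) \<Rightarrow> real \<Rightarrow> (vertex \<Rightarrow> quat) \<Rightarrow> (vertex \<Rightarrow> quat) \<Rightarrow> bool"
  where "darboux_transform \<mu> \<nu> f fh \<longleftrightarrow>
    (\<forall>i. fh i \<noteq> f i) \<and>
    (\<forall>m n. \<forall>j \<in> {(m + 1, n), (m, n + 1)}.
       cross_ratio (f (m, n)) (f j) (fh j) (fh (m, n)) = of_real (\<nu> / \<mu> {(m, n), j}))"


section \<open>The discrete homogeneous torus and the explicit transforms\<close>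

definition homogeneous_torus :: "int \<Rightarrow> int \<Rightarrow> real \<Rightarrow> real \<Rightarrow> vertex \<Rightarrow> quat"
  where "homogeneous_torus M N p q = (\<lambda>(m, n).
    q *\<^sub>R expi (2 * pi / N * n) + quat_j * (p *\<^sub>R expi (2 * pi / M * m)))"

definition alpha :: "int \<Rightarrow> int \<Rightarrow> int \<Rightarrow> quat \<Rightarrow> quat \<Rightarrow> int \<Rightarrow> quat"
  where "alpha M \<rho>1 k1 cp cm m =
    expi (- (k1 * pi / (\<rho>1 * M)) * m) * cp + expi (k1 * pi / (\<rho>1 * M) * m) * cm"

definition beta :: "int \<Rightarrow> int \<Rightarrow> int \<Rightarrow> quat \<Rightarrow> quat \<Rightarrow> int \<Rightarrow> quat"
  where "beta M \<rho>1 k1 cp cm m = quat_j *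
    (sin ((\<rho>1 + k1) * pi / (\<rho>1 * M)) *\<^sub>R expi (- (k1 * pi / (\<rho>1 * M)) * m) * cp +
     sin ((\<rho>1 - k1) * pi / (\<rho>1 * M)) *\<^sub>R expi (k1 * pi / (\<rho>1 * M) * m) * cm)"

text \<open>\<open>gamma_tilde s\<close> is \<open>\<gamma>\<^sup>+\<close> for \<open>s = 1\<close> and \<open>\<gamma>\<^sup>-\<close> for \<open>s = - 1\<close>.\<close>

definition gamma_tilde :: "int \<Rightarrow> int \<Rightarrow> int \<Rightarrow> int \<Rightarrow> int \<Rightarrow> int \<Rightarrow> int \<Rightarrow> real \<Rightarrow> real \<Rightarrow>
    quat \<Rightarrow> quat \<Rightarrow> int \<Rightarrow> quat"
  where "gamma_tilde s M N \<rho>1 \<rho>2 k1 k2 p q cp cm m =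
    sin ((\<rho>2 - s * k2) * pi / (\<rho>2 * N)) *\<^sub>R alpha M \<rho>1 k1 cp cm m +
    (q / p * sin (pi / N) * cos (k2 * pi / (\<rho>2 * N)) * (1 / sin (pi / M)) *
      (1 / cos (k1 * pi / (\<rho>1 * M)))) *\<^sub>R beta M \<rho>1 k1 cp cm m"

definition U_fun :: "int \<Rightarrow> int \<Rightarrow> int \<Rightarrow> int \<Rightarrow> int \<Rightarrow> int \<Rightarrow> real \<Rightarrow> real \<Rightarrow>
    quat \<Rightarrow> quat \<Rightarrow> int \<Rightarrow> int \<Rightarrow> quat"
  where "U_fun M N \<rho>1 \<rho>2 k1 k2 p q cp cm m n =
    expi (k2 * pi / (\<rho>2 * N) * n) * gamma_tilde 1 M N \<rho>1 \<rho>2 k1 k2 p q cp cm m -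
    expi (- (k2 * pi / (\<rho>2 * N)) * n) * gamma_tilde (- 1) M N \<rho>1 \<rho>2 k1 k2 p q cp cm m"

definition V_fun :: "int \<Rightarrow> int \<Rightarrow> int \<Rightarrow> int \<Rightarrow> int \<Rightarrow> int \<Rightarrow> real \<Rightarrow> real \<Rightarrow>
    quat \<Rightarrow> quat \<Rightarrow> int \<Rightarrow> int \<Rightarrow> quat"
  where "V_fun M N \<rho>1 \<rho>2 k1 k2 p q cp cm m n =
    sin ((\<rho>2 + k2) * pi / (\<rho>2 * N)) *\<^sub>R expi (k2 * pi / (\<rho>2 * N) * n) *
      gamma_tilde 1 M N \<rho>1 \<rho>2 k1 k2 p q cp cm m -
    sin ((\<rho>2 - k2) * pi / (\<rho>2 * N)) *\<^sub>R expi (- (k2 * pi / (\<rho>2 * N)) * n) *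
      gamma_tilde (- 1) M N \<rho>1 \<rho>2 k1 k2 p q cp cm m"

definition explicit_transform :: "int \<Rightarrow> int \<Rightarrow> int \<Rightarrow> int \<Rightarrow> int \<Rightarrow> int \<Rightarrow> real \<Rightarrow> real \<Rightarrow>
    quat \<Rightarrow> quat \<Rightarrow> vertex \<Rightarrow> quat"
  where "explicit_transform M N \<rho>1 \<rho>2 k1 k2 p q cp cm = (\<lambda>(m, n).
    homogeneous_torus M N p q (m, n) -
    (2 * q * sin (pi / N) * cos (k2 * pi / (\<rho>2 * N))) *\<^sub>R
      (expi (- (pi / M) * m) * expi (pi / N * n) *
       U_fun M N \<rho>1 \<rho>2 k1 k2 p q cp cm m n * inverse (V_fun M N \<rho>1 \<rho>2 k1 k2 p q cp cm m n) *
       expi (pi / M * m) * expi (pi / N * n)))"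

end

(* With h = fh - f, the cross-ratio condition on an edge of difference d reads
   h' = (h - d) (1 - r d^-1 h)^-1, a fractional linear recursion. Writing h = u v^-1 and removing the
   symmetry of the torus by the factors e^(i(bn - am)) and e^(i(bn + am)), where a = pi/M and
   b = pi/N, it becomes linear with constant coefficients; its eigenvalues are real multiples of
   e^(+-is) and e^(+-it), where s = k1 pi/(rho1 M) and t = k2 pi/(rho2 N), precisely because of the
   choice of p, q and nu. The explicit formula consists of the eigenvector expansions, and
   periodicity is read off the eigenvalues. The pairs (u, v) at one vertex are in bijection with the
   pairs (c+, c-), so that the recursion, which is invertible as r is never 1, produces every
   Darboux transform. *)

theory Submission
  imports Defs
begin

section \<open>Quaternions\<close>

text \<open>Where the parameters come from: the linearised m-step has determinant
  \<open>1 - r1\<close>, and with the symmetry removed and written over the complex numbers its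
  trace is \<open>2 * cos a\<close>. Eigenvalues \<open>l * expi (\<plusminus> s)\<close> with real
  \<open>l\<close> therefore force \<open>l = cos a / cos s\<close> and
  \<open>r1 = 1 - (cos a)\<^sup>2 / (cos s)\<^sup>2\<close>; likewise for n with \<open>b\<close>,
  \<open>t\<close> and \<open>r2\<close>. Since \<open>r1\<close> is
  \<open>4 * \<nu> * p\<^sup>2 * (sin a)\<^sup>2\<close> and \<open>r2\<close> is
  \<open>- (4 * \<nu> * q\<^sup>2 * (sin b)\<^sup>2)\<close>, these two conditions and
  \<open>p\<^sup>2 + q\<^sup>2 = 1\<close> are three equations for \<open>p\<^sup>2\<close>,
  \<open>q\<^sup>2\<close> and \<open>\<nu>\<close>, and the hypotheses state their solution. The
  real factor \<open>l\<close> cancels in the quotient of \<open>u\<close> and \<open>v\<close>. The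
  obstacle is noncommutativity: n-edges are multiples of \<open>quat_i\<close> and m-edges of
  \<open>quat_k\<close>, which exchanges \<open>expi x\<close> and \<open>expi (- x)\<close>, so the
  m-step mixes the eigencomponents of the n-step. Hence the nested expansion: along n with
  coefficients that depend on m, and these again along m. All coefficients act from the left, so the
  free constants stand on the right.\<close>

definition quat_i :: quat
  where "quat_i = Quat 0 1 0 0"

definition quat_k :: quat
  where "quat_k = Quat 0 0 0 1"

lemmas quat_ops = zero_quat_def one_quat_def plus_quat_def minus_quat_def uminus_quat_def
  times_quat_def scaleR_quat_def

lemma expi_eq: "expi x = Quat (cos x) (sin x) 0 0"
  by (simp add: expi_def quat_of_complex_def Re_exp Im_exp)

lemma expi_zero [simp]: "expi 0 = 1"
  by (simp add: expi_eq one_quat_def)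

lemma expi_mult: "expi x * expi y = expi (x + y)"
  by (simp add: expi_eq times_quat_def cos_add sin_add)

lemma expi_mult_left: "expi x * (expi y * z) = expi (x + y) * z"
  by (simp add: expi_mult flip: mult.assoc)

lemma norm_expi [simp]: "norm (expi x) = 1"
  by (simp add: expi_eq norm_quat_def inner_quat_def flip: power2_eq_square)

lemma expi_nonzero [simp]: "expi x \<noteq> 0"
  by (metis norm_expi norm_zero zero_neq_one)

lemma inverse_expi: "inverse (expi x) = expi (- x)"
  by (rule inverse_unique) (simp add: expi_mult)

lemma expi_shift:
  "expi (x + of_int k * pi) = cos (of_int k * pi) *\<^sub>R expi x"
  "expi (x - of_int k * pi) = cos (of_int k * pi) *\<^sub>R expi x"
  by (simp_all add: expi_eq scaleR_quat_def cos_add sin_add cos_diff sin_diff sin_zero_iff_int2)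

lemma cos_pi_int_square: "cos (of_int k * pi) * cos (of_int k * pi) = 1" for k :: int
proof -
  have "sin (of_int k * pi) = 0"
    by (simp add: sin_zero_iff_int2)
  then show ?thesis
    using sin_cos_squared_add[of "of_int k * pi"] by (simp add: power2_eq_square)
qed

lemma quat_i_expi: "quat_i * expi x = expi x * quat_i"
  by (simp add: expi_eq quat_i_def times_quat_def)

lemma quat_j_expi: "quat_j * expi x = expi (- x) * quat_j"
  by (simp add: expi_eq quat_j_def times_quat_def)

lemma quat_k_expi: "quat_k * expi x = expi (- x) * quat_k"
  by (simp add: expi_eq quat_k_def times_quat_def)

lemma quat_k_expi_left: "quat_k * (expi x * z) = expi (- x) * (quat_k * z)"
  by (simp add: quat_k_expi flip: mult.assoc)

lemma quat_i_expi_left: "quat_i * (expi x * z) = expi x * (quat_i * z)"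
  by (simp add: quat_i_expi flip: mult.assoc)

lemma qre_mult_commute: "qre (x * y) = qre (y * x)"
  by (simp add: times_quat_def)

lemma qre_diff: "qre (x - y) = qre x - qre y"
  by (simp add: minus_quat_def)

lemma qre_one: "qre 1 = 1"
  by (simp add: one_quat_def)

lemma qre_inverse: "qre (inverse x) = qre x / (norm x)\<^sup>2"
  by (simp add: inverse_quat_def scaleR_quat_def divide_inverse)

lemma norm_diff_squared: "(norm (x - y))\<^sup>2 = (norm x)\<^sup>2 - 2 * inner x y + (norm y)\<^sup>2" for x y :: quat
  by (simp add: power2_norm_eq_inner inner_diff inner_commute)

lemma inner_unit: "inner x y = qre (inverse x * y)" if "norm x = 1" for x y :: quat
  using that by (simp add: inner_quat_def inverse_quat_def times_quat_def scaleR_quat_def)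

lemma norm_unit_diff:
  fixes x y :: quat
  assumes "norm x = 1" "norm y = 1"
  shows "(norm (x - y))\<^sup>2 = 2 - 2 * qre (inverse x * y)"
  using assms by (simp add: norm_diff_squared inner_unit)


section \<open>The edge relation\<close>

text \<open>With \<open>h = fh - f\<close> at the two ends of an edge of difference \<open>d\<close>, this is the cross-ratio
  condition solved for \<open>h'\<close>.\<close>

definition darboux_edge :: "quat \<Rightarrow> real \<Rightarrow> quat \<Rightarrow> quat \<Rightarrow> bool"
  where "darboux_edge d r h h' \<longleftrightarrow> h - d = h' * (1 - r *\<^sub>R (inverse d * h))"

lemma quat_of_real: "of_real r = r *\<^sub>R (1::quat)"
  by (simp add: of_real_def)

lemma cross_ratio_iff_darboux_edge:
  assumes "a \<noteq> b" "a' \<noteq> a" "b' \<noteq> b"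
  shows "cross_ratio a b b' a' = of_real r \<longleftrightarrow> darboux_edge (b - a) r (a' - a) (b' - b)"
proof -
  define d h h' where dh: "d = b - a" "h = a' - a" "h' = b' - b"
  have nz: "d \<noteq> 0" "h \<noteq> 0" "h' \<noteq> 0"
    using assms by (auto simp: dh)
  \<comment> \<open>These factors strip the inverses of \<open>h'\<close> and \<open>h\<close> off
    the cross-ratio and leave \<open>h' + d - h = r *\<^sub>R (h' * inverse d * h)\<close>.\<close>
  have cancel: "x = y \<longleftrightarrow> h' * inverse d * x * h = h' * inverse d * y * h" for x y
    using nz by simp
  have e: "a - b = - d" "b - b' = - h'" "b' - a' = h' + d - h" "a' - a = h"
    by (simp_all add: dh)
  have "cross_ratio a b b' a' = of_real r \<longleftrightarrow> d * inverse h' * (h' + d - h) * inverse h = r *\<^sub>R 1"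
    unfolding cross_ratio_def e using nz by (simp add: quat_of_real nonzero_inverse_minus_eq)
  also have "\<dots> \<longleftrightarrow> h' * inverse d * (d * inverse h' * (h' + d - h) * inverse h) * h
      = h' * inverse d * (r *\<^sub>R 1) * h"
    by (rule cancel)
  also have "h' * inverse d * (d * inverse h' * (h' + d - h) * inverse h) * h
      = h' * (inverse d * d) * inverse h' * (h' + d - h) * (inverse h * h)"
    by (simp only: mult.assoc)
  also have "\<dots> = h' + d - h"
    using nz by simp
  also have "h' + d - h = h' * inverse d * (r *\<^sub>R 1) * h \<longleftrightarrow> darboux_edge d r h h'"
    by (auto simp: darboux_edge_def algebra_simps)
  finally show ?thesis
    by (simp add: dh)
qed

text \<open>At a zero of the denominator \<open>h - d\<close> vanishes as well, so
  \<open>h = d\<close> and the denominator is \<open>1 - r\<close>.\<close>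

lemma darboux_edge_denominator_nonzero:
  assumes "darboux_edge d r h h'" "d \<noteq> 0" "r \<noteq> 1"
  shows "1 - r *\<^sub>R (inverse d * h) \<noteq> 0"
proof
  assume z: "1 - r *\<^sub>R (inverse d * h) = 0"
  with assms(1) have "h = d"
    by (simp add: darboux_edge_def)
  with z assms(2) have "(1 - r) *\<^sub>R (1 :: quat) = 0"
    by (simp add: algebra_simps)
  with assms(3) show False
    by simp
qed

text \<open>In the scaled variables \<open>H\<close> and \<open>H'\<close> the relation makes
  \<open>H'\<close> a fractional linear function of \<open>H\<close> with real coefficients. The two
  therefore commute, and the relation can be solved for \<open>h\<close> instead of
  \<open>h'\<close>.\<close>

lemma darboux_edge_sym:
  assumes edge: "darboux_edge d r h h'" and d: "d \<noteq> 0" and r: "r \<noteq> 1"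
  shows "darboux_edge (- d) r h' h"
proof -
  define H H' where HH: "H = inverse d * h" "H' = inverse d * h'"
  define A where "A = 1 - r *\<^sub>R H"
  have h: "h = d * H" "h' = d * H'"
    using d by (simp_all add: HH flip: mult.assoc)
  have A: "A \<noteq> 0"
    using darboux_edge_denominator_nonzero[OF assms] by (simp add: A_def HH)
  have "d * (H - 1) = h - d"
    by (simp add: h(1) right_diff_distrib)
  also have "\<dots> = h' * A"
    using edge by (simp add: darboux_edge_def A_def HH(1))
  also have "\<dots> = d * (H' * A)"
    by (simp add: h(2) mult.assoc)
  finally have "d * (H - 1) = d * (H' * A)" .
  with d have e: "H - 1 = H' * A"
    by simp
  have comm: "H * A = A * H"
    by (simp add: A_def algebra_simps)
  have "H * H' * A = H * (H - 1)"
    by (simp add: e mult.assoc)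
  also have "\<dots> = (H - 1) * H"
    by (simp add: algebra_simps)
  also have "\<dots> = H' * H * A"
    by (simp add: e mult.assoc comm)
  finally have HH': "H * H' = H' * H"
    using A by simp
  have "H' + 1 = H + r *\<^sub>R (H * H')"
    unfolding HH' using e by (simp add: A_def algebra_simps)
  then have "d * (H' + 1) = d * H + r *\<^sub>R (d * H * H')"
    by (simp add: distrib_left mult.assoc)
  then have "h' + d = h + r *\<^sub>R (h * H')"
    by (simp add: distrib_left flip: h)
  then show ?thesis
    using d by (simp add: darboux_edge_def nonzero_inverse_minus_eq distrib_left HH(2))
qed

text \<open>The left side is the edge of \<open>fh\<close>. Having the product in either order lets
  neighbouring factors cancel in a cross-ratio of four such edges.\<close>

lemma darboux_edge_hat_diff:
  assumes "darboux_edge d r h h'" "d \<noteq> 0" "r \<noteq> 1"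
  shows "h' + d - h = r *\<^sub>R (h' * inverse d * h)" "h' + d - h = r *\<^sub>R (h * inverse d * h')"
  subgoal using assms(1) by (simp add: darboux_edge_def algebra_simps)
  subgoal using darboux_edge_sym[OF assms] assms(2)
    by (simp add: darboux_edge_def nonzero_inverse_minus_eq algebra_simps)
  done

text \<open>The pair \<open>u\<close>, \<open>v\<close> serves as homogeneous coordinates of
  \<open>h\<close>. The real normalisation \<open>l\<close> scales both new coordinates alike and so
  does not affect \<open>h'\<close>.\<close>

lemma darboux_edge_transport:
  assumes edge: "darboux_edge d r h h'" and d: "d \<noteq> 0" and r: "r \<noteq> 1" and l: "l \<noteq> 0"
    and u': "l *\<^sub>R u' = u - d * v" and v': "l *\<^sub>R v' = v - r *\<^sub>R (inverse d * u)"
    and u: "u = h * v" and v: "v \<noteq> 0"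
  shows "u' = h' * v' \<and> v' \<noteq> 0"
proof -
  define A where "A = 1 - r *\<^sub>R (inverse d * h)"
  have A: "A \<noteq> 0"
    using darboux_edge_denominator_nonzero[OF edge d r] by (simp add: A_def)
  have lv: "l *\<^sub>R v' = A * v"
    by (simp add: v' u A_def algebra_simps)
  have "l *\<^sub>R u' = (h - d) * v"
    by (simp add: u' u algebra_simps)
  also have "\<dots> = h' * (A * v)"
    using edge by (simp add: darboux_edge_def A_def mult.assoc)
  also have "\<dots> = l *\<^sub>R (h' * v')"
    by (simp flip: lv)
  finally show ?thesis
    using lv A v l by auto
qed

lemma darboux_edge_intro:
  assumes v: "v \<noteq> 0"
    and u': "l *\<^sub>R u' = u - d * v" and v': "l *\<^sub>R v' = v - r *\<^sub>R (inverse d * u)"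
    and u: "u = h * v" "u' = h' * v'"
  shows "darboux_edge d r h h'"
proof -
  have "(h - d) * v = l *\<^sub>R u'"
    by (simp add: u' u(1) algebra_simps)
  also have "\<dots> = h' * (l *\<^sub>R v')"
    by (simp add: u(2))
  also have "\<dots> = h' * (1 - r *\<^sub>R (inverse d * h)) * v"
    by (simp add: v' u(1) algebra_simps)
  finally show ?thesis
    using v by (simp add: darboux_edge_def)
qed

text \<open>The linearised edge relation can be traversed backwards because its determinant is \<open>1 - r\<close>.\<close>

lemma darboux_edge_transport_iff:
  assumes edge: "darboux_edge d r h h'" and d: "d \<noteq> 0" and r: "r \<noteq> 1" and l: "l \<noteq> 0"
    and u': "l *\<^sub>R u' = u - d * v" and v': "l *\<^sub>R v' = v - r *\<^sub>R (inverse d * u)"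
  shows "u = h * v \<and> v \<noteq> 0 \<longleftrightarrow> u' = h' * v' \<and> v' \<noteq> 0"
proof
  assume *: "u' = h' * v' \<and> v' \<noteq> 0"
  \<comment> \<open>The adjugate of the linear step is the step of the edge \<open>- d\<close>, so
    the forward transport applies to the reversed edge with normalisation
    \<open>(1 - r) / l\<close>.\<close>
  have "((1 - r) / l) *\<^sub>R u = (1 / l) *\<^sub>R (l *\<^sub>R u' + d * (l *\<^sub>R v'))"
    unfolding u' v' using d by (simp add: algebra_simps diff_divide_distrib flip: mult.assoc)
  also have "\<dots> = u' - (- d) * v'"
    using l by (simp add: scaleR_add_right)
  finally have 1: "((1 - r) / l) *\<^sub>R u = u' - (- d) * v'" .
  have "((1 - r) / l) *\<^sub>R v = (1 / l) *\<^sub>R (l *\<^sub>R v' + r *\<^sub>R (inverse d * (l *\<^sub>R u')))"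
    unfolding u' v' using d by (simp add: algebra_simps diff_divide_distrib flip: mult.assoc)
  also have "\<dots> = v' - r *\<^sub>R (inverse (- d) * u')"
    using l d by (simp add: scaleR_add_right nonzero_inverse_minus_eq)
  finally have 2: "((1 - r) / l) *\<^sub>R v = v' - r *\<^sub>R (inverse (- d) * u')" .
  show "u = h * v \<and> v \<noteq> 0"
    by (rule darboux_edge_transport[OF darboux_edge_sym[OF edge d r] _ r _ 1 2]) (use * d r l in auto)
qed (use darboux_edge_transport[OF assms] in blast)

text \<open>The quadrilateral of \<open>f\<close> is a parallelogram with sides \<open>d\<close> and
  \<open>e\<close>. With each edge of \<open>fh\<close> written as a product in a suitable order,
  \<open>hj\<close>, \<open>hk\<close> and \<open>hl\<close> cancel, and what remains is a real
  multiple of \<open>inverse d * e * inverse d * e\<close> conjugated by \<open>hi\<close>. This is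
  real by \<open>sq\<close>, so the conjugation has no effect.\<close>

lemma cross_ratio_darboux_parallelogram:
  assumes edges: "darboux_edge d r (fi' - fi) (fj' - (fi + d))" "darboux_edge d r (fl' - (fi + e)) (fk' - (fi + d + e))"
      "darboux_edge e r' (fi' - fi) (fl' - (fi + e))" "darboux_edge e r' (fj' - (fi + d)) (fk' - (fi + d + e))"
    and nz: "d \<noteq> 0" "e \<noteq> 0" "r \<noteq> 0" "r' \<noteq> 0" "r \<noteq> 1" "r' \<noteq> 1"
      "fi' - fi \<noteq> 0" "fj' - (fi + d) \<noteq> 0" "fk' - (fi + d + e) \<noteq> 0" "fl' - (fi + e) \<noteq> 0"
    and sq: "(d * inverse e)\<^sup>2 = of_real (r / r')"
  shows "cross_ratio fi' fj' fk' fl' = of_real (r / r')"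
proof -
  define hi hj hk hl where h: "hi = fi' - fi" "hj = fj' - (fi + d)" "hk = fk' - (fi + d + e)" "hl = fl' - (fi + e)"
  have hnz: "hi \<noteq> 0" "hj \<noteq> 0" "hk \<noteq> 0" "hl \<noteq> 0"
    using nz by (simp_all add: h)
  note E = edges[folded h]
  have ij: "fi' - fj' = - r *\<^sub>R (hi * inverse d * hj)"
    using darboux_edge_hat_diff(2)[OF E(1)] nz by (simp add: h algebra_simps)
  have jk: "fj' - fk' = - r' *\<^sub>R (hk * inverse e * hj)"
    using darboux_edge_hat_diff(1)[OF E(4)] nz by (simp add: h algebra_simps)
  have kl: "fk' - fl' = r *\<^sub>R (hk * inverse d * hl)"
    using darboux_edge_hat_diff(1)[OF E(2)] nz by (simp add: h algebra_simps)
  have li: "fl' - fi' = r' *\<^sub>R (hi * inverse e * hl)"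
    using darboux_edge_hat_diff(2)[OF E(3)] nz by (simp add: h algebra_simps)
  have inv: "inverse (hk * inverse e * hj) = inverse hj * e * inverse hk"
      "inverse (hi * inverse e * hl) = inverse hl * e * inverse hi"
    using hnz nz by (simp_all add: nonzero_inverse_mult_distrib mult.assoc)
  have "cross_ratio fi' fj' fk' fl' = (r / r')\<^sup>2 *\<^sub>R
     (hi * inverse d * (hj * inverse hj) * e * (inverse hk * hk) * inverse d * (hl * inverse hl) * e * inverse hi)"
    unfolding cross_ratio_def ij jk kl li inverse_scaleR_distrib inv
    by (simp add: mult.assoc power2_eq_square divide_inverse mult_ac)
  also have "\<dots> = (r / r')\<^sup>2 *\<^sub>R (hi * (inverse d * e * inverse d * e) * inverse hi)"
    using hnz by (simp add: mult.assoc)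
  also have "inverse d * e * inverse d * e = of_real (r' / r)"
  proof -
    have "inverse d * e * inverse d * e = inverse (inverse e * (d * inverse e)\<^sup>2 * e)"
      using nz by (simp add: nonzero_inverse_mult_distrib power2_eq_square mult.assoc)
    also have "\<dots> = of_real (r' / r)"
      unfolding sq using nz by (simp add: quat_of_real inverse_scaleR_distrib)
    finally show ?thesis .
  qed
  also have "(r / r')\<^sup>2 *\<^sub>R (hi * of_real (r' / r) * inverse hi) = of_real (r / r')"
    using hnz nz by (simp add: quat_of_real power2_eq_square)
  finally show ?thesis .
qed

text \<open>Clearing the denominator gives
  \<open>g' * A = f' * (inverse f' * g - r *\<^sub>R X)\<close> with
  \<open>A = 1 - r *\<^sub>R X\<close>. As \<open>inverse f' * g\<close> and \<open>1\<close> are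
  both of norm 1, it suffices that they have the same inner product with \<open>X\<close>.\<close>

lemma darboux_edge_sphere:
  assumes edge: "darboux_edge (f' - f) r (g - f) (g' - f')"
    and unit: "norm f = 1" "norm f' = 1" "norm g = 1" and nz: "f' \<noteq> f" "r \<noteq> 1"
  shows "norm g' = 1"
proof -
  define d where "d = f' - f"
  define X where "X = inverse d * (g - f)"
  define A where "A = 1 - r *\<^sub>R X"
  have d: "d \<noteq> 0"
    using nz by (simp add: d_def)
  have A: "A \<noteq> 0"
    using darboux_edge_denominator_nonzero[OF edge] nz by (simp add: A_def X_def d_def)
  have fnz: "f \<noteq> 0" "f' \<noteq> 0" "g \<noteq> 0"
    using unit by auto
  have "g' * A = g - r *\<^sub>R (f' * X)"
    using edge by (simp add: darboux_edge_def A_def X_def d_def algebra_simps)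
  also have "\<dots> = f' * (inverse f' * g - r *\<^sub>R X)"
    using fnz by (simp add: right_diff_distrib flip: mult.assoc)
  finally have "norm (g' * A) = norm (inverse f' * g - r *\<^sub>R X)"
    using unit by (simp add: norm_mult)
  also have "\<dots> = norm A"
  proof -
    have nd: "(norm d)\<^sup>2 = 2 - 2 * qre (inverse f' * f)"
      unfolding d_def by (rule norm_unit_diff) (use unit in auto)
    \<comment> \<open>A point of the unit sphere projects onto a chord ending there as half of the
      chord.\<close>
    have half: "qre (f' * inverse d) = 1 / 2"
    proof -
      have "qre (f' * inverse d) = qre (inverse (d * inverse f'))"
        using d fnz by (simp add: nonzero_inverse_mult_distrib)
      also have "\<dots> = qre (d * inverse f') / (norm d)\<^sup>2"
        using unit by (simp add: qre_inverse norm_mult norm_inverse)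
      also have "qre (d * inverse f') = 1 - qre (inverse f' * f)"
        using fnz by (simp add: d_def left_diff_distrib qre_diff qre_one qre_mult_commute)
      also have "(1 - qre (inverse f' * f)) / (norm d)\<^sup>2 = 1 / 2"
        using d nd by (simp add: field_simps)
      finally show ?thesis .
    qed
    have half': "qre (inverse d * f) = - 1 / 2"
    proof -
      have "f = f' - d"
        by (simp add: d_def)
      then have "inverse d * f = inverse d * f' - 1"
        using d by (simp add: right_diff_distrib)
      then show ?thesis
        using half by (simp add: qre_diff qre_one qre_mult_commute)
    qed
    \<comment> \<open>The inverse of \<open>f' * inverse d * f\<close> is
      \<open>inverse f - inverse f'\<close>. Inversion of unit quaternions is conjugation, so this
      difference is the conjugate of \<open>- d\<close>.\<close>
    have w: "qre (inverse g * (f' * inverse d * f)) = - qre (inverse d * g)"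
    proof -
      have "f' * inverse d * f = inverse (inverse f * d * inverse f')"
        using fnz d by (simp add: nonzero_inverse_mult_distrib mult.assoc)
      also have "inverse f * d * inverse f' = inverse f - inverse f'"
        using fnz by (simp add: d_def right_diff_distrib left_diff_distrib mult.assoc)
      finally have *: "inverse g * (f' * inverse d * f) = inverse ((inverse f - inverse f') * g)"
        using fnz unit nz by (simp add: nonzero_inverse_mult_distrib)
      have ud: "norm (inverse f - inverse f') = norm d"
        using unit by (simp add: d_def norm_quat_def inner_quat_def inverse_quat_def minus_quat_def scaleR_quat_def
            algebra_simps)
      have "qre (inverse g * (f' * inverse d * f)) = qre ((inverse f - inverse f') * g) / (norm d)\<^sup>2"
        unfolding * qre_inverse by (simp add: norm_mult ud unit)
      also have "\<dots> = - qre (inverse d * g)"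
        using unit d by (simp add: d_def inverse_quat_def minus_quat_def times_quat_def scaleR_quat_def field_simps)
      finally show ?thesis .
    qed
    have "qre (inverse (inverse f' * g) * X) = qre (inverse g * f' * inverse d * g) - qre (inverse g * (f' * inverse d * f))"
      using fnz by (simp add: X_def nonzero_inverse_mult_distrib right_diff_distrib mult.assoc)
        (simp add: qre_diff)
    also have "qre (inverse g * f' * inverse d * g) = qre (g * (inverse g * (f' * inverse d)))"
      by (subst qre_mult_commute) (simp add: mult.assoc)
    also have "\<dots> = 1 / 2"
      using fnz half by (simp flip: mult.assoc)
    finally have "qre (inverse (inverse f' * g) * X) = qre X"
      using half' w by (simp add: X_def right_diff_distrib qre_diff)
    then have "inner (inverse f' * g) X = inner 1 X"
      using unit by (simp add: inner_unit norm_mult norm_inverse)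
    then have "(norm (inverse f' * g - r *\<^sub>R X))\<^sup>2 = (norm A)\<^sup>2"
      unfolding A_def norm_diff_squared using unit by (simp add: norm_mult norm_inverse)
    then show ?thesis
      by simp
  qed
  finally show ?thesis
    using A by (simp add: norm_mult)
qed

text \<open>Equivalences along the edges let a property spread from one vertex in all four
  directions.\<close>

lemma int_lattice_induct:
  fixes P :: "int \<Rightarrow> int \<Rightarrow> bool"
  assumes "P m0 n0" "\<And>m n. P m n \<longleftrightarrow> P (m + 1) n" "\<And>m n. P m n \<longleftrightarrow> P m (n + 1)"
  shows "P m n"
proof -
  have "P m n0"
  proof (induction m rule: int_induct[where k = m0])
    case (step2 i)
    then show ?case using assms(2)[of "i - 1"] by simp
  qed (use assms in auto)
  then show ?thesis
  proof (induction n rule: int_induct[where k = n0])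
    case (step2 i)
    then show ?case using assms(3)[of m "i - 1"] by simp
  qed (use assms in auto)
qed


section \<open>The explicit transforms\<close>

lemma quat_i_products: "quat_j * quat_i = - quat_k" "quat_k * quat_j = - quat_i"
    "quat_j * (quat_i * x) = - (quat_k * x)" "quat_k * (quat_j * x) = - (quat_i * x)"
    "inverse quat_i = - quat_i" "inverse quat_k = - quat_k"
proof -
  show *: "quat_j * quat_i = - quat_k" "quat_k * quat_j = - quat_i"
    by (simp_all add: quat_i_def quat_j_def quat_k_def quat_ops)
  show "quat_j * (quat_i * x) = - (quat_k * x)" "quat_k * (quat_j * x) = - (quat_i * x)"
    by (simp_all add: * flip: mult.assoc)
  show "inverse quat_i = - quat_i" "inverse quat_k = - quat_k"
    by (rule inverse_unique; simp add: quat_i_def quat_k_def quat_ops)+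
qed

lemma expi_diff: "expi (x + 2 * y) - expi x = (2 * sin y) *\<^sub>R (quat_i * expi (x + y))"
proof -
  define z where "z = x + y"
  have "x + 2 * y = z + y" "x = z - y"
    by (simp_all add: z_def)
  then show ?thesis
    by (simp add: expi_eq quat_i_def quat_ops cos_add sin_add cos_diff sin_diff)
qed

lemma norm_one_minus_expi: "(norm (1 - expi (2 * x)))\<^sup>2 = 4 * (sin x)\<^sup>2"
proof -
  have "norm (expi (0 + 2 * x) - expi 0) = 2 * \<bar>sin x\<bar>"
    unfolding expi_diff by (simp add: norm_mult quat_i_def norm_quat_def[of "Quat 0 1 0 0"] inner_quat_def)
  then have "norm (1 - expi (2 * x)) = 2 * \<bar>sin x\<bar>"
    by (simp add: norm_minus_commute)
  then show ?thesis
    by (simp add: power_mult_distrib)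
qed

lemma sin_add_sin_diff: "sin (x + y) * sin (x - y) = (cos y)\<^sup>2 - (cos x)\<^sup>2" for x y :: real
proof -
  have "sin (x + y) * sin (x - y) = (sin x)\<^sup>2 * (cos y)\<^sup>2 - (cos x)\<^sup>2 * (sin y)\<^sup>2"
    by (simp add: sin_add sin_diff power2_eq_square algebra_simps)
  then show ?thesis
    by (simp add: sin_squared_eq algebra_simps)
qed

text \<open>The scalar identities behind the eigenvectors of both steps: on the right a diagonal
  entry and the coupling to the other component, on the left the eigenvalue. The factor
  \<open>cos x / cos y\<close> is the one that makes the real parts agree.\<close>

lemma expi_eigenvalue:
  assumes "cos y \<noteq> 0"
  shows "(cos x / cos y) *\<^sub>R expi (- y) = expi x - (sin (x + y) / cos y) *\<^sub>R quat_i"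
    and "(cos x / cos y) *\<^sub>R expi y = expi x - (sin (x - y) / cos y) *\<^sub>R quat_i"
    and "(cos x / cos y) *\<^sub>R expi (- y) = expi (- x) + (sin (x - y) / cos y) *\<^sub>R quat_i"
    and "(cos x / cos y) *\<^sub>R expi y = expi (- x) + (sin (x + y) / cos y) *\<^sub>R quat_i"
  using assms by (simp_all add: expi_eq quat_i_def quat_ops sin_add sin_diff field_simps)

section \<open>Angles, constants and the choice of \<open>p\<close>, \<open>q\<close> and
  \<open>\<nu>\<close>\<close>

locale torus_parameters =
  fixes M N \<rho>1 \<rho>2 k1 k2 :: int and p q \<nu> :: real
  assumes M: "M > 2" and N: "N > 2" and \<rho>1: "\<rho>1 > 0" and \<rho>2: "\<rho>2 > 0"
    and cos_s': "cos (k1 * pi / (\<rho>1 * M)) \<noteq> 0" and tan_s': "tan (k1 * pi / (\<rho>1 * M)) \<noteq> 0"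
    and cos_t': "cos (k2 * pi / (\<rho>2 * N)) \<noteq> 0" and tan_t': "tan (k2 * pi / (\<rho>2 * N)) \<noteq> 0"
    and p: "p \<noteq> 0" and q: "q \<noteq> 0"
    and p2: "p\<^sup>2 = (1 - (cot (pi / M))\<^sup>2 * (tan (k1 * pi / (\<rho>1 * M)))\<^sup>2) /
      ((cot (pi / N))\<^sup>2 * (tan (k2 * pi / (\<rho>2 * N)))\<^sup>2 -
       (cot (pi / M))\<^sup>2 * (tan (k1 * pi / (\<rho>1 * M)))\<^sup>2)"
    and q2: "q\<^sup>2 = (1 - (cot (pi / N))\<^sup>2 * (tan (k2 * pi / (\<rho>2 * N)))\<^sup>2) /
      ((cot (pi / M))\<^sup>2 * (tan (k1 * pi / (\<rho>1 * M)))\<^sup>2 -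
       (cot (pi / N))\<^sup>2 * (tan (k2 * pi / (\<rho>2 * N)))\<^sup>2)"
    and \<nu>: "\<nu> = 1 / 4 * ((cot (pi / N))\<^sup>2 * (tan (k2 * pi / (\<rho>2 * N)))\<^sup>2 -
       (cot (pi / M))\<^sup>2 * (tan (k1 * pi / (\<rho>1 * M)))\<^sup>2)"
begin

definition a :: real where "a = pi / M"
definition b :: real where "b = pi / N"
definition s :: real where "s = k1 * pi / (\<rho>1 * M)"
definition t :: real where "t = k2 * pi / (\<rho>2 * N)"
text \<open>\<open>\<kappa>\<close> is the real prefactor of the explicit formula,
  \<open>\<omega>\<close> the coefficient of \<open>beta\<close> in \<open>gamma_tilde\<close>, and
  \<open>P\<close> the strength with which the m-step feeds \<open>V\<close> into \<open>U\<close>.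
  \<open>r1\<close> and \<open>r2\<close> are the quotients of \<open>\<nu>\<close> by
  \<open>\<mu>\<close> on the two kinds of edges.\<close>

definition \<kappa> :: real where "\<kappa> = - (2 * q * sin b * cos t)"
definition \<omega> :: real where "\<omega> = q / p * sin b * cos t * (1 / sin a) * (1 / cos s)"
definition P :: real where "P = 2 * p * sin a / \<kappa>"
definition r1 :: real where "r1 = 4 * \<nu> * p\<^sup>2 * (sin a)\<^sup>2"
definition r2 :: real where "r2 = - (4 * \<nu> * q\<^sup>2 * (sin b)\<^sup>2)"

lemma angle_facts: "sin a > 0" "cos a > 0" "sin b > 0" "cos b > 0" "cos s \<noteq> 0" "cos t \<noteq> 0" "sin s \<noteq> 0" "sin t \<noteq> 0"
proof -
  have "0 < pi / x \<and> pi / x < pi / 2" if "x > 2" for x :: real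
    using that by (simp add: field_simps)
  from this[of "of_int M"] this[of "of_int N"] M N
  have "0 < a" "a < pi / 2" "0 < b" "b < pi / 2"
    by (simp_all add: a_def b_def)
  then show "sin a > 0" "cos a > 0" "sin b > 0" "cos b > 0"
    by (auto intro: sin_gt_zero cos_gt_zero)
  show "cos s \<noteq> 0" "cos t \<noteq> 0" "sin s \<noteq> 0" "sin t \<noteq> 0"
    using cos_s' cos_t' tan_s' tan_t' by (simp_all add: s_def t_def tan_def)
qed

lemma parameter_facts: "p\<^sup>2 + q\<^sup>2 = 1" "\<nu> \<noteq> 0"
  "r1 = 1 - (cos a)\<^sup>2 / (cos s)\<^sup>2" "r2 = 1 - (cos b)\<^sup>2 / (cos t)\<^sup>2"
proof -
  define A B where AB: "A = (cot a)\<^sup>2 * (tan s)\<^sup>2" "B = (cot b)\<^sup>2 * (tan t)\<^sup>2"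
  have p2': "p\<^sup>2 = (1 - A) / (B - A)" and q2': "q\<^sup>2 = (1 - B) / (A - B)" and \<nu>': "\<nu> = (B - A) / 4"
    using p2 q2 \<nu> by (simp_all add: AB a_def b_def s_def t_def)
  \<comment> \<open>Division by zero yields 0, so \<open>B = A\<close> would make \<open>p\<close>
    zero.\<close>
  have ne: "B - A \<noteq> 0"
    using p p2' by auto
  then have ne': "A - B \<noteq> 0"
    by simp
  show "p\<^sup>2 + q\<^sup>2 = 1"
    unfolding p2' q2' using ne ne' by (simp add: divide_simps)  (simp add: algebra_simps)
  show "\<nu> \<noteq> 0"
    using ne by (simp add: \<nu>')
  have 1: "4 * \<nu> * p\<^sup>2 = 1 - A" and 2: "- (4 * \<nu> * q\<^sup>2) = 1 - B"
    unfolding \<nu>' p2' q2' using ne ne' by (simp_all add: divide_simps) (simp_all add: algebra_simps)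
  \<comment> \<open>The squared sine comes from the edge length of the torus; it turns
    \<open>1 - A\<close> and \<open>1 - B\<close> into \<open>r1\<close> and
    \<open>r2\<close>.\<close>
  have *: "(1 - (cot x)\<^sup>2 * (tan y)\<^sup>2) * (sin x)\<^sup>2 = 1 - (cos x)\<^sup>2 / (cos y)\<^sup>2"
    if "sin x > 0" "cos y \<noteq> 0" for x y :: real
  proof -
    have "(1 - (cot x)\<^sup>2 * (tan y)\<^sup>2) * (sin x)\<^sup>2 = (sin x)\<^sup>2 - (cos x)\<^sup>2 * (sin y)\<^sup>2 / (cos y)\<^sup>2"
      using that by (simp add: cot_def tan_def power_divide algebra_simps)
    also have "\<dots> = 1 - (cos x)\<^sup>2 / (cos y)\<^sup>2"
      unfolding sin_squared_eq using that by (simp add: field_simps)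
    finally show ?thesis .
  qed
  show "r1 = 1 - (cos a)\<^sup>2 / (cos s)\<^sup>2"
    unfolding r1_def 1 AB by (rule *) (use angle_facts in auto)
  have "r2 = - (4 * \<nu> * q\<^sup>2) * (sin b)\<^sup>2"
    by (simp add: r2_def)
  also have "\<dots> = 1 - (cos b)\<^sup>2 / (cos t)\<^sup>2"
    unfolding 2 AB by (rule *) (use angle_facts in auto)
  finally show "r2 = 1 - (cos b)\<^sup>2 / (cos t)\<^sup>2" .
qed

text \<open>The determinants \<open>1 - r1\<close> and \<open>1 - r2\<close> are the squares of
  \<open>cos a / cos s\<close> and \<open>cos b / cos t\<close>, which are nonzero because
  \<open>M\<close> and \<open>N\<close> exceed 2.\<close>

lemma r_bounds: "r1 \<noteq> 0" "r2 \<noteq> 0" "r1 \<noteq> 1" "r2 \<noteq> 1"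
  subgoal using angle_facts parameter_facts(2) p by (simp add: r1_def)
  subgoal using angle_facts parameter_facts(2) q by (simp add: r2_def)
  subgoal using angle_facts parameter_facts(3) by simp
  subgoal using angle_facts parameter_facts(4) by simp
  done

text \<open>The sines are the weights of the eigencomponents in \<open>beta\<close> and
  \<open>V_fun\<close>. Through these factorisations the second rows of the steps reduce to
  \<open>expi_eigenvalue\<close>.\<close>

lemma r_products: "r1 = sin (a + s) * sin (a - s) / (cos s)\<^sup>2" "r2 = sin (b + t) * sin (b - t) / (cos t)\<^sup>2"
  using angle_facts by (simp_all add: parameter_facts sin_add_sin_diff diff_divide_distrib)

text \<open>The last two equations make the two directions compatible: the coupling in the m-step
  that the expansion along n produces agrees with the one required by \<open>alpha\<close> and
  \<open>beta\<close> and with the one required by \<open>r1\<close>. Behind this is that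
  \<open>r1 / r2\<close>, the cross-ratio of the torus, is minus the square of
  \<open>p * sin a / (q * sin b)\<close>.\<close>

lemma constant_facts: "\<kappa> \<noteq> 0" "\<omega> \<noteq> 0" "P \<noteq> 0" "P * \<omega> = - (1 / cos s)" "P * \<kappa> = 2 * p * sin a"
  "P * (sin (b + t) * sin (b - t)) = \<omega> * (sin (a + s) * sin (a - s) / cos s)"
  "P * (sin (b + t) * sin (b - t)) = - (r1 / P)"
proof -
  show \<kappa>: "\<kappa> \<noteq> 0" and \<omega>: "\<omega> \<noteq> 0" and P: "P \<noteq> 0" and P\<omega>: "P * \<omega> = - (1 / cos s)"
    and "P * \<kappa> = 2 * p * sin a"
    using angle_facts p q by (auto simp: \<kappa>_def \<omega>_def P_def)
  have P': "P = - (p * sin a / (q * sin b * cos t))"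
    using angle_facts q by (simp add: P_def \<kappa>_def)
  have "P * (sin (b + t) * sin (b - t)) = P * (r2 * (cos t)\<^sup>2)"
    using angle_facts by (simp add: r_products)
  also have "\<dots> = - (r1 / P)"
    unfolding r1_def r2_def P' using angle_facts p q by (simp add: field_simps power2_eq_square)
  finally show *: "P * (sin (b + t) * sin (b - t)) = - (r1 / P)" .
  have "- (1 / P) = \<omega> * cos s"
    using P P\<omega> angle_facts(5) by (simp add: field_simps)
  then have "r1 * - (1 / P) = r1 * (\<omega> * cos s)"
    by (rule arg_cong)
  then have "- (r1 / P) = \<omega> * (r1 * cos s)"
    by (simp add: mult.left_commute)
  also have "r1 * cos s = sin (a + s) * sin (a - s) / cos s"
    using angle_facts(5) by (simp add: r_products power2_eq_square)
  finally show "P * (sin (b + t) * sin (b - t)) = \<omega> * (sin (a + s) * sin (a - s) / cos s)"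
    by (simp add: *)
qed

lemma angles:
  "(real_of_int \<rho>1 + real_of_int k1) * pi / (real_of_int \<rho>1 * real_of_int M) = a + s"
  "(real_of_int \<rho>1 - real_of_int k1) * pi / (real_of_int \<rho>1 * real_of_int M) = a - s"
  "(real_of_int \<rho>2 + real_of_int k2) * pi / (real_of_int \<rho>2 * real_of_int N) = b + t"
  "(real_of_int \<rho>2 - real_of_int k2) * pi / (real_of_int \<rho>2 * real_of_int N) = b - t"
  using \<rho>1 \<rho>2 M N by (simp_all add: a_def b_def s_def t_def field_simps)

section \<open>Edges, cross-ratios and periods of the torus\<close>

definition dm :: "int \<Rightarrow> quat"
  where "dm m = - (2 * p * sin a) *\<^sub>R (quat_k * expi (2 * a * m + a))"

definition dn :: "int \<Rightarrow> quat"
  where "dn n = (2 * q * sin b) *\<^sub>R (quat_i * expi (2 * b * n + b))"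

abbreviation "f \<equiv> homogeneous_torus M N p q"

lemma torus_eq: "f (m, n) = q *\<^sub>R expi (2 * b * n) + p *\<^sub>R (quat_j * expi (2 * a * m))"
  by (simp add: homogeneous_torus_def a_def b_def)

text \<open>A difference of exponentials contributes a factor \<open>quat_i\<close>, which becomes
  \<open>- quat_k\<close> behind the \<open>quat_j\<close> of the m-circle. Each difference depends
  on one index only, so the elementary quadrilaterals are parallelograms.\<close>

lemma torus_step: "f (m + 1, n) = f (m, n) + dm m" "f (m, n + 1) = f (m, n) + dn n"
proof -
  have *: "expi (2 * x * of_int (k + 1)) = expi (2 * x * k) + (2 * sin x) *\<^sub>R (quat_i * expi (2 * x * k + x))"
    for x :: real and k :: int
    using expi_diff[of "2 * x * k" x] by (simp add: algebra_simps)
  show "f (m + 1, n) = f (m, n) + dm m" "f (m, n + 1) = f (m, n) + dn n"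
    unfolding torus_eq * dm_def dn_def by (simp_all add: quat_i_products algebra_simps)
qed

lemma torus_diff: "f (m + 1, n) - f (m, n) = dm m" "f (m, n + 1) - f (m, n) = dn n"
  by (simp_all add: torus_step)

lemma quat_ik_nonzero [simp]: "quat_i \<noteq> 0" "quat_k \<noteq> 0"
  by (simp_all add: quat_i_def quat_k_def zero_quat_def)

lemma d_nonzero: "dm m \<noteq> 0" "dn n \<noteq> 0"
  using angle_facts p q by (simp_all add: dm_def dn_def)

lemma torus_regular: "f (m + 1, n) \<noteq> f (m, n)" "f (m, n + 1) \<noteq> f (m, n)"
  using d_nonzero by (simp_all add: torus_step)

lemma inverse_d:
  "inverse (dm m) = (1 / (2 * p * sin a)) *\<^sub>R (expi (- (2 * a * m + a)) * quat_k)"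
  "inverse (dn n) = - (1 / (2 * q * sin b)) *\<^sub>R (expi (- (2 * b * n + b)) * quat_i)"
proof -
  have sq: "quat_k * quat_k = - 1" "quat_i * quat_i = - 1"
    by (simp_all add: quat_i_def quat_k_def quat_ops)
  show "inverse (dm m) = (1 / (2 * p * sin a)) *\<^sub>R (expi (- (2 * a * m + a)) * quat_k)"
    by (rule inverse_unique) (use p angle_facts in \<open>simp add: dm_def mult.assoc expi_mult_left sq\<close>)
  show "inverse (dn n) = - (1 / (2 * q * sin b)) *\<^sub>R (expi (- (2 * b * n + b)) * quat_i)"
    by (rule inverse_unique) (use q angle_facts in \<open>simp add: dn_def mult.assoc expi_mult_left sq\<close>)
qed

text \<open>The quotient is a real multiple of \<open>expi (- x) * quat_j\<close>, an imaginary
  unit, so its square is a negative real number.\<close>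

lemma d_quotient_square: "(dm m * inverse (dn n))\<^sup>2 = of_real (r1 / r2)"
proof -
  define x where "x = 2 * a * m + a - (2 * b * n + b)"
  have ki: "quat_k * quat_i = quat_j" and jj: "quat_j * quat_j = - 1"
    by (simp_all add: quat_i_def quat_j_def quat_k_def quat_ops)
  have "dm m * inverse (dn n) = (p * sin a / (q * sin b)) *\<^sub>R (quat_k * expi x * quat_i)"
    unfolding inverse_d by (simp add: dm_def mult.assoc expi_mult_left) (simp add: x_def algebra_simps)
  also have "quat_k * expi x * quat_i = expi (- x) * quat_j"
    by (simp add: quat_k_expi mult.assoc ki)
  finally have "(dm m * inverse (dn n))\<^sup>2
      = (p * sin a / (q * sin b))\<^sup>2 *\<^sub>R (expi (- x) * (quat_j * expi (- x)) * quat_j)"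
    by (simp add: power2_eq_square mult.assoc)
  also have "expi (- x) * (quat_j * expi (- x)) * quat_j = - 1"
    unfolding quat_j_expi by (simp add: expi_mult_left mult.assoc jj)
  also have "(p * sin a / (q * sin b))\<^sup>2 = - (r1 / r2)"
    using parameter_facts(2) by (simp add: r1_def r2_def power_mult_distrib power_divide)
  finally show ?thesis
    by (simp add: quat_of_real)
qed

lemma norm_torus: "norm (f (m, n)) = 1"
proof -
  define x y where xy: "x = 2 * b * n" "y = 2 * a * m"
  have "(norm (f (m, n)))\<^sup>2 = (q * cos x)\<^sup>2 + (q * sin x)\<^sup>2 + (p * cos y)\<^sup>2 + (p * sin y)\<^sup>2"
    unfolding torus_eq power2_norm_eq_inner
    by (simp add: expi_eq quat_j_def quat_ops inner_quat_def power2_eq_square flip: xy)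
  also have "\<dots> = q\<^sup>2 * ((sin x)\<^sup>2 + (cos x)\<^sup>2) + p\<^sup>2 * ((sin y)\<^sup>2 + (cos y)\<^sup>2)"
    by (simp only: power_mult_distrib distrib_left add_ac)
  also have "\<dots> = 1"
    using parameter_facts(1) by (simp add: add.commute)
  finally show ?thesis
    by (simp add: abs_square_eq_1)
qed

lemma torus_periodic: "f (m + \<rho>1 * M, n) = f (m, n)" "f (m, n + \<rho>2 * N) = f (m, n)"
proof -
  have "2 * a * of_int (m + \<rho>1 * M) = 2 * a * m + of_int (2 * \<rho>1) * pi"
    "2 * b * of_int (n + \<rho>2 * N) = 2 * b * n + of_int (2 * \<rho>2) * pi"
    using M N by (simp_all add: a_def b_def field_simps)
  moreover have "cos (of_int (2 * k) * pi) = 1" for k :: int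
    using cos_int_2pin[of k] by (simp add: mult_ac)
  ultimately show "f (m + \<rho>1 * M, n) = f (m, n)" "f (m, n + \<rho>2 * N) = f (m, n)"
    unfolding torus_eq by (simp_all only: expi_shift) simp_all
qed

section \<open>The linear system solved by \<open>U\<close> and \<open>V\<close>\<close>

context
  fixes cp cm :: quat
begin

abbreviation "\<alpha> \<equiv> alpha M \<rho>1 k1 cp cm"
abbreviation "\<beta> \<equiv> beta M \<rho>1 k1 cp cm"
abbreviation "\<gamma>p \<equiv> gamma_tilde 1 M N \<rho>1 \<rho>2 k1 k2 p q cp cm"
abbreviation "\<gamma>m \<equiv> gamma_tilde (- 1) M N \<rho>1 \<rho>2 k1 k2 p q cp cm"
abbreviation "U \<equiv> U_fun M N \<rho>1 \<rho>2 k1 k2 p q cp cm"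
abbreviation "V \<equiv> V_fun M N \<rho>1 \<rho>2 k1 k2 p q cp cm"

lemma alpha_eq: "\<alpha> m = expi (- s * m) * cp + expi (s * m) * cm"
  by (simp add: alpha_def s_def)

lemma beta_eq: "\<beta> m = quat_j * (sin (a + s) *\<^sub>R (expi (- s * m) * cp) + sin (a - s) *\<^sub>R (expi (s * m) * cm))"
  by (simp add: beta_def angles) (simp add: s_def)

text \<open>The weights are chosen so that on the row n = 0 \<open>\<beta>\<close> drops out of
  \<open>U\<close> and \<open>\<alpha>\<close> out of \<open>V\<close>: there \<open>U\<close> and
  \<open>V\<close> are real multiples of \<open>\<alpha>\<close> and \<open>\<beta>\<close>.\<close>

lemma gamma_eq: "\<gamma>p m = sin (b - t) *\<^sub>R \<alpha> m + \<omega> *\<^sub>R \<beta> m" "\<gamma>m m = sin (b + t) *\<^sub>R \<alpha> m + \<omega> *\<^sub>R \<beta> m"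
  by (simp_all add: gamma_tilde_def angles \<omega>_def) (simp_all add: a_def b_def s_def t_def)

lemma U_eq: "U m n = expi (t * n) * \<gamma>p m - expi (- t * n) * \<gamma>m m"
  by (simp add: U_fun_def t_def)

lemma V_eq: "V m n = sin (b + t) *\<^sub>R (expi (t * n) * \<gamma>p m) - sin (b - t) *\<^sub>R (expi (- t * n) * \<gamma>m m)"
  by (simp add: V_fun_def angles) (simp add: t_def)

text \<open>One step turns the components \<open>x\<close> and \<open>y\<close> by
  \<open>expi (- s)\<close> and \<open>expi s\<close>; \<open>quat_k * quat_j = - quat_i\<close>
  converts the coupling with \<open>\<beta>\<close> into the \<open>quat_i\<close> terms of
  \<open>expi_eigenvalue\<close>.\<close>

lemma alpha_step: "(cos a / cos s) *\<^sub>R \<alpha> (m + 1) = expi a * \<alpha> m + (1 / cos s) *\<^sub>R (quat_k * \<beta> m)"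
proof -
  define x y where xy: "x = expi (- s * m) * cp" "y = expi (s * m) * cm"
  have \<alpha>\<beta>: "\<alpha> m = x + y" "\<beta> m = quat_j * (sin (a + s) *\<^sub>R x + sin (a - s) *\<^sub>R y)"
    by (simp_all add: alpha_eq beta_eq xy)
  have "\<alpha> (m + 1) = expi (- s) * x + expi s * y"
    by (simp add: alpha_eq xy expi_mult_left algebra_simps)
  then have "(cos a / cos s) *\<^sub>R \<alpha> (m + 1) = ((cos a / cos s) *\<^sub>R expi (- s)) * x + ((cos a / cos s) *\<^sub>R expi s) * y"
    by (simp add: scaleR_add_right)
  also have "\<dots> = expi a * \<alpha> m + (1 / cos s) *\<^sub>R (quat_k * \<beta> m)"
    unfolding expi_eigenvalue(1,2)[OF angle_facts(5)]
    by (simp add: \<alpha>\<beta> quat_i_products algebra_simps)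
  finally show ?thesis .
qed

text \<open>Moving \<open>expi (- a)\<close> out past the leading \<open>quat_j\<close> gives
  \<open>expi a\<close>, which is why the eigenvalues are expanded here with the opposite sign of
  \<open>a\<close>.\<close>

lemma beta_step: "(cos a / cos s) *\<^sub>R \<beta> (m + 1) = expi a * \<beta> m - (sin (a + s) * sin (a - s) / cos s) *\<^sub>R (quat_k * \<alpha> m)"
proof -
  define x y where xy: "x = expi (- s * m) * cp" "y = expi (s * m) * cm"
  have \<alpha>\<beta>: "\<alpha> m = x + y" "\<beta> m = quat_j * (sin (a + s) *\<^sub>R x + sin (a - s) *\<^sub>R y)"
    by (simp_all add: alpha_eq beta_eq xy)
  have "\<beta> (m + 1) = quat_j * (sin (a + s) *\<^sub>R (expi (- s) * x) + sin (a - s) *\<^sub>R (expi s * y))"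
    by (simp add: beta_eq xy expi_mult_left algebra_simps)
  then have "(cos a / cos s) *\<^sub>R \<beta> (m + 1) = quat_j * (sin (a + s) *\<^sub>R (((cos a / cos s) *\<^sub>R expi (- s)) * x)
      + sin (a - s) *\<^sub>R (((cos a / cos s) *\<^sub>R expi s) * y))"
    by (simp add: scaleR_add_right distrib_left mult.commute)
  also have "\<dots> = (quat_j * expi (- a)) * (sin (a + s) *\<^sub>R x + sin (a - s) *\<^sub>R y)
      + (sin (a + s) * sin (a - s) / cos s) *\<^sub>R ((quat_j * quat_i) * (x + y))"
    unfolding expi_eigenvalue(3,4)[OF angle_facts(5)]
    by (simp add: algebra_simps)
  also have "\<dots> = expi a * \<beta> m - (sin (a + s) * sin (a - s) / cos s) *\<^sub>R (quat_k * \<alpha> m)"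
    unfolding quat_j_expi quat_i_products by (simp add: \<alpha>\<beta> mult.assoc)
  finally show ?thesis .
qed

text \<open>In the m-step \<open>quat_k\<close> reverses the phases
  \<open>expi (\<plusminus> t * n)\<close>, so its coupling has to exchange the two coefficients.
  Both equations are one computation, with the two sines interchanged.\<close>

lemma gamma_step:
  "(cos a / cos s) *\<^sub>R \<gamma>p (m + 1) = expi a * \<gamma>p m - (P * sin (b - t)) *\<^sub>R (quat_k * \<gamma>m m)"
  "(cos a / cos s) *\<^sub>R \<gamma>m (m + 1) = expi a * \<gamma>m m - (P * sin (b + t)) *\<^sub>R (quat_k * \<gamma>p m)"
proof -
  have "(cos a / cos s) *\<^sub>R (x *\<^sub>R \<alpha> (m + 1) + \<omega> *\<^sub>R \<beta> (m + 1)) =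
     expi a * (x *\<^sub>R \<alpha> m + \<omega> *\<^sub>R \<beta> m) - (P * x) *\<^sub>R (quat_k * (y *\<^sub>R \<alpha> m + \<omega> *\<^sub>R \<beta> m))"
    if xy: "x * y = sin (b + t) * sin (b - t)" for x y
  proof -
    have "(cos a / cos s) *\<^sub>R (x *\<^sub>R \<alpha> (m + 1) + \<omega> *\<^sub>R \<beta> (m + 1)) =
       x *\<^sub>R ((cos a / cos s) *\<^sub>R \<alpha> (m + 1)) + \<omega> *\<^sub>R ((cos a / cos s) *\<^sub>R \<beta> (m + 1))"
      by (simp add: scaleR_add_right mult.commute)
    also have "\<dots> = expi a * (x *\<^sub>R \<alpha> m + \<omega> *\<^sub>R \<beta> m) - (x * - (1 / cos s)) *\<^sub>R (quat_k * \<beta> m)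
       - (\<omega> * (sin (a + s) * sin (a - s) / cos s)) *\<^sub>R (quat_k * \<alpha> m)"
      unfolding alpha_step beta_step by (simp add: algebra_simps)
    also have "\<dots> = expi a * (x *\<^sub>R \<alpha> m + \<omega> *\<^sub>R \<beta> m) - (P * x) *\<^sub>R (quat_k * (y *\<^sub>R \<alpha> m + \<omega> *\<^sub>R \<beta> m))"
      unfolding constant_facts(4)[symmetric] constant_facts(6)[symmetric] xy[symmetric]
      by (simp add: algebra_simps)
    finally show ?thesis .
  qed
  from this[of "sin (b - t)" "sin (b + t)"] this[of "sin (b + t)" "sin (b - t)"]
  show "(cos a / cos s) *\<^sub>R \<gamma>p (m + 1) = expi a * \<gamma>p m - (P * sin (b - t)) *\<^sub>R (quat_k * \<gamma>m m)"
    "(cos a / cos s) *\<^sub>R \<gamma>m (m + 1) = expi a * \<gamma>m m - (P * sin (b + t)) *\<^sub>R (quat_k * \<gamma>p m)"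
    by (simp_all add: gamma_eq mult.commute)
qed

lemma UV_step_m:
  "(cos a / cos s) *\<^sub>R U (m + 1) n = expi a * U m n + P *\<^sub>R (quat_k * V m n)"
  "(cos a / cos s) *\<^sub>R V (m + 1) n = expi a * V m n - (r1 / P) *\<^sub>R (quat_k * U m n)"
proof -
  have comm: "expi x * (expi a * z) = expi a * (expi x * z)" for x z
    by (simp add: expi_mult_left add.commute)
  have "(cos a / cos s) *\<^sub>R U (m + 1) n =
     expi (t * n) * ((cos a / cos s) *\<^sub>R \<gamma>p (m + 1)) - expi (- t * n) * ((cos a / cos s) *\<^sub>R \<gamma>m (m + 1))"
    by (simp add: U_eq scaleR_diff_right)
  also have "\<dots> = expi a * U m n + P *\<^sub>R (quat_k * V m n)"
    unfolding gamma_step by (simp add: U_eq V_eq comm quat_k_expi_left algebra_simps)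
  finally show "(cos a / cos s) *\<^sub>R U (m + 1) n = expi a * U m n + P *\<^sub>R (quat_k * V m n)" .
  have "(cos a / cos s) *\<^sub>R V (m + 1) n =
     sin (b + t) *\<^sub>R (expi (t * n) * ((cos a / cos s) *\<^sub>R \<gamma>p (m + 1)))
     - sin (b - t) *\<^sub>R (expi (- t * n) * ((cos a / cos s) *\<^sub>R \<gamma>m (m + 1)))"
    by (simp add: V_eq scaleR_diff_right mult.commute)
  also have "\<dots> = expi a * V m n + (P * (sin (b + t) * sin (b - t))) *\<^sub>R (quat_k * U m n)"
    unfolding gamma_step by (simp add: U_eq V_eq comm quat_k_expi_left algebra_simps)
  finally show "(cos a / cos s) *\<^sub>R V (m + 1) n = expi a * V m n - (r1 / P) *\<^sub>R (quat_k * U m n)"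
    by (simp add: constant_facts(7))
qed

text \<open>The vectors \<open>(1, sin (b + t))\<close> and \<open>(1, sin (b - t))\<close> are
  eigenvectors of this step, with phases \<open>expi t\<close> and \<open>expi (- t)\<close>;
  \<open>\<gamma>p m\<close> and \<open>- \<gamma>m m\<close> are their coefficients.\<close>

lemma UV_step_n:
  "(cos b / cos t) *\<^sub>R U m (n + 1) = expi (- b) * U m n + (1 / cos t) *\<^sub>R (quat_i * V m n)"
  "(cos b / cos t) *\<^sub>R V m (n + 1) = expi b * V m n - (r2 * cos t) *\<^sub>R (quat_i * U m n)"
proof -
  define x y where xy: "x = expi (t * n) * \<gamma>p m" "y = expi (- t * n) * \<gamma>m m"
  have UV: "U m n = x - y" "V m n = sin (b + t) *\<^sub>R x - sin (b - t) *\<^sub>R y"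
    by (simp_all add: U_eq V_eq xy)
  have U1: "U m (n + 1) = expi t * x - expi (- t) * y"
    by (simp add: U_eq xy expi_mult_left algebra_simps)
  have V1: "V m (n + 1) = sin (b + t) *\<^sub>R (expi t * x) - sin (b - t) *\<^sub>R (expi (- t) * y)"
    by (simp add: V_eq xy expi_mult_left algebra_simps)
  have r2: "r2 * cos t = sin (b + t) * sin (b - t) / cos t"
    using angle_facts(6) by (simp add: r_products power2_eq_square)
  have "(cos b / cos t) *\<^sub>R U m (n + 1) = ((cos b / cos t) *\<^sub>R expi t) * x - ((cos b / cos t) *\<^sub>R expi (- t)) * y"
    by (simp add: U1 scaleR_diff_right)
  also have "\<dots> = expi (- b) * U m n + (1 / cos t) *\<^sub>R (quat_i * V m n)"
    unfolding expi_eigenvalue(3,4)[OF angle_facts(6)]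
    by (simp add: UV algebra_simps)
  finally show "(cos b / cos t) *\<^sub>R U m (n + 1) = expi (- b) * U m n + (1 / cos t) *\<^sub>R (quat_i * V m n)" .
  have "(cos b / cos t) *\<^sub>R V m (n + 1) = sin (b + t) *\<^sub>R (((cos b / cos t) *\<^sub>R expi t) * x)
      - sin (b - t) *\<^sub>R (((cos b / cos t) *\<^sub>R expi (- t)) * y)"
    by (simp add: V1 scaleR_diff_right mult.commute)
  also have "\<dots> = expi b * V m n - (r2 * cos t) *\<^sub>R (quat_i * U m n)"
    unfolding expi_eigenvalue(1,2)[OF angle_facts(6)] r2
    by (simp add: UV algebra_simps)
  finally show "(cos b / cos t) *\<^sub>R V m (n + 1) = expi b * V m n - (r2 * cos t) *\<^sub>R (quat_i * U m n)" .
qed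


text \<open>With \<open>v\<close> below, the quotient is the image of
  \<open>\<kappa> *\<^sub>R (U m n * inverse (V m n))\<close> under the rotation that multiplies by
  \<open>expi (b * n - a * m)\<close> on the left and \<open>expi (b * n + a * m)\<close> on the
  right. This rotation carries \<open>f (0, 0)\<close> to \<open>f (m, n)\<close>.\<close>

definition u :: "int \<Rightarrow> int \<Rightarrow> quat"
  where "u m n = \<kappa> *\<^sub>R (expi (b * n - a * m) * U m n)"

definition v :: "int \<Rightarrow> int \<Rightarrow> quat"
  where "v m n = expi (- (b * n + a * m)) * V m n"

text \<open>Along m the prefactors of \<open>u\<close> and \<open>v\<close> both turn by
  \<open>expi (- a)\<close>, which absorbs the \<open>expi a\<close> in both rows of
  \<open>UV_step_m\<close>. Along n they turn in opposite directions, hence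
  \<open>expi (- b)\<close> and \<open>expi b\<close> in \<open>UV_step_n\<close>.\<close>

lemma uv_step_m:
  "(cos a / cos s) *\<^sub>R u (m + 1) n = u m n - dm m * v m n"
  "(cos a / cos s) *\<^sub>R v (m + 1) n = v m n - r1 *\<^sub>R (inverse (dm m) * u m n)"
proof -
  define E F where EF: "E = expi (b * n - a * m - a)" "F = expi (- (b * n + a * m) - a)"
  have "(cos a / cos s) *\<^sub>R u (m + 1) n = \<kappa> *\<^sub>R (E * ((cos a / cos s) *\<^sub>R U (m + 1) n))"
    by (simp add: u_def EF algebra_simps)
  also have "\<dots> = \<kappa> *\<^sub>R (E * expi a * U m n) + (P * \<kappa>) *\<^sub>R (E * (quat_k * V m n))"
    unfolding UV_step_m by (simp add: algebra_simps)
  also have "E * expi a = expi (b * n - a * m)"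
    by (simp add: EF expi_mult)
  also have "(P * \<kappa>) *\<^sub>R (E * (quat_k * V m n)) = - (dm m * v m n)"
    unfolding constant_facts(5) dm_def v_def EF
    by (simp add: mult.assoc expi_mult_left quat_k_expi_left algebra_simps)
  finally show "(cos a / cos s) *\<^sub>R u (m + 1) n = u m n - dm m * v m n"
    by (simp add: u_def)
  have "F = expi (- (b * n + a * of_int (m + 1)))"
    unfolding EF by (rule arg_cong[where f = expi]) (simp add: algebra_simps)
  then have "(cos a / cos s) *\<^sub>R v (m + 1) n = F * ((cos a / cos s) *\<^sub>R V (m + 1) n)"
    by (simp add: v_def)
  also have "\<dots> = F * expi a * V m n - (r1 / P) *\<^sub>R (F * (quat_k * U m n))"
    unfolding UV_step_m by (simp add: algebra_simps)
  also have "F * expi a = expi (- (b * n + a * m))"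
    by (simp add: EF expi_mult)
  also have "(r1 / P) *\<^sub>R (F * (quat_k * U m n)) = r1 *\<^sub>R (inverse (dm m) * u m n)"
  proof -
    have "- (2 * a * m + a) + - (b * n - a * m) = - (b * n + a * m) - a"
      by simp
    then have "expi (- (2 * a * m + a)) * (quat_k * (expi (b * n - a * m) * U m n)) = F * (quat_k * U m n)"
      by (simp only: quat_k_expi_left expi_mult_left EF)
    then show ?thesis
      unfolding inverse_d u_def by (simp add: P_def mult.assoc)
  qed
  finally show "(cos a / cos s) *\<^sub>R v (m + 1) n = v m n - r1 *\<^sub>R (inverse (dm m) * u m n)"
    by (simp add: v_def)
qed

lemma uv_step_n:
  "(cos b / cos t) *\<^sub>R u m (n + 1) = u m n - dn n * v m n"
  "(cos b / cos t) *\<^sub>R v m (n + 1) = v m n - r2 *\<^sub>R (inverse (dn n) * u m n)"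
proof -
  define E F where EF: "E = expi (b * n - a * m + b)" "F = expi (- (b * n + a * m) - b)"
  have "(cos b / cos t) *\<^sub>R u m (n + 1) = \<kappa> *\<^sub>R (E * ((cos b / cos t) *\<^sub>R U m (n + 1)))"
    by (simp add: u_def EF algebra_simps)
  also have "\<dots> = \<kappa> *\<^sub>R (E * expi (- b) * U m n) + (\<kappa> / cos t) *\<^sub>R (E * (quat_i * V m n))"
    unfolding UV_step_n by (simp add: algebra_simps)
  also have "E * expi (- b) = expi (b * n - a * m)"
    by (simp add: EF expi_mult)
  also have "\<kappa> / cos t = - (2 * q * sin b)"
    using angle_facts(6) by (simp add: \<kappa>_def)
  also have "(- (2 * q * sin b)) *\<^sub>R (E * (quat_i * V m n)) = - (dn n * v m n)"
    unfolding dn_def v_def EF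
    by (simp add: mult.assoc expi_mult_left quat_i_expi_left algebra_simps)
  finally show "(cos b / cos t) *\<^sub>R u m (n + 1) = u m n - dn n * v m n"
    by (simp add: u_def)
  have "F = expi (- (b * of_int (n + 1) + a * m))"
    unfolding EF by (rule arg_cong[where f = expi]) (simp add: algebra_simps)
  then have "(cos b / cos t) *\<^sub>R v m (n + 1) = F * ((cos b / cos t) *\<^sub>R V m (n + 1))"
    by (simp add: v_def)
  also have "\<dots> = F * expi b * V m n - (r2 * cos t) *\<^sub>R (F * (quat_i * U m n))"
    unfolding UV_step_n by (simp add: algebra_simps)
  also have "F * expi b = expi (- (b * n + a * m))"
    by (simp add: EF expi_mult)
  also have "r2 * cos t = r2 * (- (1 / (2 * q * sin b)) * \<kappa>)"
    using angle_facts q by (simp add: \<kappa>_def)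
  also have "(r2 * (- (1 / (2 * q * sin b)) * \<kappa>)) *\<^sub>R (F * (quat_i * U m n)) = r2 *\<^sub>R (inverse (dn n) * u m n)"
  proof -
    have "- (2 * b * n + b) + (b * n - a * m) = - (b * n + a * m) - b"
      by simp
    then have "expi (- (2 * b * n + b)) * (quat_i * (expi (b * n - a * m) * U m n)) = F * (quat_i * U m n)"
      by (simp only: quat_i_expi_left expi_mult_left EF)
    then show ?thesis
      unfolding inverse_d u_def by (simp add: mult.assoc)
  qed
  finally show "(cos b / cos t) *\<^sub>R v m (n + 1) = v m n - r2 *\<^sub>R (inverse (dn n) * u m n)"
    by (simp add: v_def)
qed

lemma uv_nonzero: "u m n \<noteq> 0 \<longleftrightarrow> U m n \<noteq> 0" "v m n \<noteq> 0 \<longleftrightarrow> V m n \<noteq> 0"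
  using constant_facts(1) by (simp_all add: u_def v_def)

lemma explicit_transform_eq:
  assumes "V m n \<noteq> 0"
  shows "explicit_transform M N \<rho>1 \<rho>2 k1 k2 p q cp cm (m, n) = f (m, n) + u m n * inverse (v m n)"
proof -
  have "inverse (v m n) = inverse (V m n) * (expi (a * m) * expi (b * n))"
    using assms by (simp add: v_def nonzero_inverse_mult_distrib inverse_expi expi_mult add.commute)
  moreover have "expi (- a * m) * expi (b * n) = expi (b * n - a * m)"
    by (simp add: expi_mult)
  ultimately show ?thesis
    by (simp add: explicit_transform_def u_def \<kappa>_def mult.assoc) (simp add: a_def b_def t_def expi_mult_left)
qed

text \<open>A period moves every phase by an integer multiple of pi. Opposite phases receive the
  same sign, so \<open>u\<close> and \<open>v\<close> acquire one common sign, which cancels in the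
  quotient.\<close>

lemma uv_periodic:
  "u (m + \<rho>1 * M) n * inverse (v (m + \<rho>1 * M) n) = u m n * inverse (v m n)"
  "u m (n + \<rho>2 * N) * inverse (v m (n + \<rho>2 * N)) = u m n * inverse (v m n)"
proof -
  define c1 c2 e1 e2 where ce: "c1 = cos (of_int k1 * pi)" "c2 = cos (of_int k2 * pi)"
    "e1 = cos (of_int \<rho>1 * pi)" "e2 = cos (of_int \<rho>2 * pi)"
  have ce': "c1 \<noteq> 0" "c2 \<noteq> 0" "e1 \<noteq> 0" "e2 \<noteq> 0"
    unfolding ce using cos_pi_int_square by (metis mult_zero_left zero_neq_one)+
  have sh: "s * of_int (m + \<rho>1 * M) = s * m + of_int k1 * pi" "- s * of_int (m + \<rho>1 * M) = - s * m - of_int k1 * pi"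
    "t * of_int (n + \<rho>2 * N) = t * n + of_int k2 * pi" "- t * of_int (n + \<rho>2 * N) = - t * n - of_int k2 * pi"
    using \<rho>1 \<rho>2 M N by (simp_all add: s_def t_def field_simps)
  have sh2: "b * n - a * of_int (m + \<rho>1 * M) = (b * n - a * m) - of_int \<rho>1 * pi"
    "- (b * n + a * of_int (m + \<rho>1 * M)) = - (b * n + a * m) - of_int \<rho>1 * pi"
    "b * of_int (n + \<rho>2 * N) - a * m = (b * n - a * m) + of_int \<rho>2 * pi"
    "- (b * of_int (n + \<rho>2 * N) + a * m) = - (b * n + a * m) - of_int \<rho>2 * pi"
    using M N by (simp_all add: a_def b_def field_simps)
  have "\<alpha> (m + \<rho>1 * M) = c1 *\<^sub>R \<alpha> m" "\<beta> (m + \<rho>1 * M) = c1 *\<^sub>R \<beta> m"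
    unfolding alpha_eq beta_eq sh expi_shift ce by (simp_all add: scaleR_add_right distrib_left mult.commute)
  then have "\<gamma>p (m + \<rho>1 * M) = c1 *\<^sub>R \<gamma>p m" "\<gamma>m (m + \<rho>1 * M) = c1 *\<^sub>R \<gamma>m m"
    unfolding gamma_eq by (simp_all add: scaleR_add_right mult.commute)
  then have UV1: "U (m + \<rho>1 * M) n = c1 *\<^sub>R U m n" "V (m + \<rho>1 * M) n = c1 *\<^sub>R V m n"
    unfolding U_eq V_eq by (simp_all add: scaleR_diff_right mult.commute)
  have UV2: "U m (n + \<rho>2 * N) = c2 *\<^sub>R U m n" "V m (n + \<rho>2 * N) = c2 *\<^sub>R V m n"
    unfolding U_eq V_eq sh expi_shift ce by (simp_all add: scaleR_diff_right mult.commute)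
  have ratio: "(c *\<^sub>R x) * inverse (c *\<^sub>R y) = x * inverse y" if "c \<noteq> 0" for c and x y :: quat
    using that by (simp add: inverse_scaleR_distrib)
  have uv: "u (m + \<rho>1 * M) n = (e1 * c1) *\<^sub>R u m n" "v (m + \<rho>1 * M) n = (e1 * c1) *\<^sub>R v m n"
    "u m (n + \<rho>2 * N) = (e2 * c2) *\<^sub>R u m n" "v m (n + \<rho>2 * N) = (e2 * c2) *\<^sub>R v m n"
    unfolding u_def v_def sh2 expi_shift UV1 UV2 by (simp_all add: ce mult_ac)
  show "u (m + \<rho>1 * M) n * inverse (v (m + \<rho>1 * M) n) = u m n * inverse (v m n)"
    "u m (n + \<rho>2 * N) * inverse (v m (n + \<rho>2 * N)) = u m n * inverse (v m n)"
    unfolding uv by (rule ratio; simp add: ce')+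
qed

lemma explicit_transform_periodic:
  assumes "\<And>m n. V m n \<noteq> 0" and "fh = explicit_transform M N \<rho>1 \<rho>2 k1 k2 p q cp cm"
  shows "fh (m + \<rho>1 * M, n) = fh (m, n)" "fh (m, n + \<rho>2 * N) = fh (m, n)"
  unfolding assms(2) explicit_transform_eq[OF assms(1)] uv_periodic torus_periodic by (rule refl)+

end

text \<open>At the origin \<open>U\<close> and \<open>V\<close> prescribe \<open>\<alpha>\<close>
  and \<open>\<beta>\<close> separately, which leaves a real 2 by 2 system for \<open>cp\<close> and
  \<open>cm\<close> with determinant \<open>\<epsilon>\<close> up to sign. \<open>\<delta>\<close>
  and \<open>\<epsilon>\<close> are nonzero because \<open>sin t\<close> and \<open>sin s\<close>
  are, that is, because the two eigenvalues in each direction differ.\<close>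

lemma initial_values: "\<exists>cp cm. U_fun M N \<rho>1 \<rho>2 k1 k2 p q cp cm 0 0 = x \<and> V_fun M N \<rho>1 \<rho>2 k1 k2 p q cp cm 0 0 = y"
proof -
  define \<delta> where "\<delta> = sin (b - t) - sin (b + t)"
  define \<epsilon> where "\<epsilon> = sin (a + s) - sin (a - s)"
  have nz: "\<delta> \<noteq> 0" "\<epsilon> \<noteq> 0"
    using angle_facts by (simp_all add: \<delta>_def \<epsilon>_def sin_add sin_diff)
  define A where "A = (1 / \<delta>) *\<^sub>R x"
  \<comment> \<open>Chosen so that \<open>quat_j * B\<close> is the value that \<open>beta\<close>
    must have at 0.\<close>
  define B where "B = - (quat_j * ((- 1 / (\<delta> * \<omega>)) *\<^sub>R y))"
  define cp where "cp = (1 / \<epsilon>) *\<^sub>R (B - sin (a - s) *\<^sub>R A)"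
  define cm where "cm = A - cp"
  have jj: "quat_j * (quat_j * z) = - z" for z
    by (simp add: quat_j_def quat_ops)
  have \<alpha>0: "alpha M \<rho>1 k1 cp cm 0 = A"
    by (simp add: alpha_eq cm_def)
  have "sin (a + s) *\<^sub>R cp + sin (a - s) *\<^sub>R cm = \<epsilon> *\<^sub>R cp + sin (a - s) *\<^sub>R A"
    by (simp add: cm_def \<epsilon>_def algebra_simps)
  also have "\<dots> = B"
    using nz by (simp add: cp_def)
  finally have \<beta>0: "beta M \<rho>1 k1 cp cm 0 = (- 1 / (\<delta> * \<omega>)) *\<^sub>R y"
    by (simp add: beta_eq B_def jj)
  have "U_fun M N \<rho>1 \<rho>2 k1 k2 p q cp cm 0 0 = \<delta> *\<^sub>R A"
    by (simp add: U_eq gamma_eq \<alpha>0 \<beta>0 \<delta>_def algebra_simps)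
  moreover have "V_fun M N \<rho>1 \<rho>2 k1 k2 p q cp cm 0 0 = - (\<delta> * \<omega>) *\<^sub>R beta M \<rho>1 k1 cp cm 0"
    by (simp add: V_eq gamma_eq \<alpha>0 \<delta>_def algebra_simps)
  ultimately show ?thesis
    using nz constant_facts(2) by (intro exI[of _ cp] exI[of _ cm]) (simp add: A_def \<beta>0)
qed

section \<open>Darboux transforms as solutions of the edge relations\<close>

context
  fixes \<mu> :: "vertex set \<Rightarrow> real"
  assumes \<mu>1: "\<And>m n. 1 / \<mu> {(m, n), (m + 1, n)} = p\<^sup>2 * (norm (1 - expi (2 * pi / M)))\<^sup>2"
    and \<mu>2: "\<And>m n. 1 / \<mu> {(m, n), (m, n + 1)} = - (q\<^sup>2 * (norm (1 - expi (2 * pi / N)))\<^sup>2)"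
begin

lemma mu_eq: "\<mu> {(m, n), (m + 1, n)} = \<nu> / r1" "\<mu> {(m, n), (m, n + 1)} = \<nu> / r2"
proof -
  have "1 / \<mu> {(m, n), (m + 1, n)} = r1 / \<nu>" "1 / \<mu> {(m, n), (m, n + 1)} = r2 / \<nu>"
    unfolding \<mu>1 \<mu>2 using norm_one_minus_expi[of a] norm_one_minus_expi[of b] parameter_facts(2)
    by (simp_all add: a_def b_def r1_def r2_def)
  then show "\<mu> {(m, n), (m + 1, n)} = \<nu> / r1" "\<mu> {(m, n), (m, n + 1)} = \<nu> / r2"
    by (metis divide_divide_eq_right div_by_1 mult_1 inverse_divide inverse_inverse_eq inverse_eq_divide)+
qed

lemma factorising: "factorising_function \<mu>"
proof -
  have "{(m + 1, n + 1), (m, n + 1)} = {(m, n + 1), (m + 1, n + 1)}" for m n :: int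
    by (rule insert_commute)
  then show ?thesis
    using r_bounds parameter_facts(2) by (simp add: factorising_function_def mu_eq)
qed

lemma discrete_isothermic_iff: "discrete_isothermic \<mu> g \<longleftrightarrow>
    (\<forall>m n. cross_ratio (g (m, n)) (g (m + 1, n)) (g (m + 1, n + 1)) (g (m, n + 1)) = of_real (r1 / r2))"
  using factorising parameter_facts(2) by (simp add: discrete_isothermic_def mu_eq)

lemma torus_isothermic: "discrete_isothermic \<mu> f"
  unfolding discrete_isothermic_iff
proof (intro allI)
  fix m n
  have "cross_ratio (f (m, n)) (f (m + 1, n)) (f (m + 1, n + 1)) (f (m, n + 1)) =
      - dm m * inverse (- dn n) * dm m * inverse (dn n)"
    by (simp add: cross_ratio_def torus_step)
  also have "\<dots> = (dm m * inverse (dn n))\<^sup>2"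
    using d_nonzero by (simp add: nonzero_inverse_minus_eq power2_eq_square mult.assoc)
  finally show "cross_ratio (f (m, n)) (f (m + 1, n)) (f (m + 1, n + 1)) (f (m, n + 1)) = of_real (r1 / r2)"
    by (simp only: d_quotient_square)
qed

lemma darboux_transform_iff: "darboux_transform \<mu> \<nu> f fh \<longleftrightarrow> (\<forall>i. fh i \<noteq> f i) \<and>
    (\<forall>m n. darboux_edge (dm m) r1 (fh (m, n) - f (m, n)) (fh (m + 1, n) - f (m + 1, n)) \<and>
      darboux_edge (dn n) r2 (fh (m, n) - f (m, n)) (fh (m, n + 1) - f (m, n + 1)))"
proof -
  have "cross_ratio (f (m, n)) (f (m + 1, n)) (fh (m + 1, n)) (fh (m, n)) = of_real r1
      \<longleftrightarrow> darboux_edge (dm m) r1 (fh (m, n) - f (m, n)) (fh (m + 1, n) - f (m + 1, n))"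
    "cross_ratio (f (m, n)) (f (m, n + 1)) (fh (m, n + 1)) (fh (m, n)) = of_real r2
      \<longleftrightarrow> darboux_edge (dn n) r2 (fh (m, n) - f (m, n)) (fh (m, n + 1) - f (m, n + 1))"
    if "\<forall>i. fh i \<noteq> f i" for m n
    using cross_ratio_iff_darboux_edge[of "f (m, n)" "f (m + 1, n)" "fh (m, n)" "fh (m + 1, n)" r1]
      cross_ratio_iff_darboux_edge[of "f (m, n)" "f (m, n + 1)" "fh (m, n)" "fh (m, n + 1)" r2]
      that torus_regular[symmetric] by (simp_all add: torus_diff)
  moreover have "\<nu> / \<mu> {(m, n), (m + 1, n)} = r1" "\<nu> / \<mu> {(m, n), (m, n + 1)} = r2" for m n
    using parameter_facts(2) by (simp_all add: mu_eq)
  ultimately show ?thesis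
    by (auto simp: darboux_transform_def simp del: of_real_divide)
qed

text \<open>Nonzero \<open>V\<close> makes the quotient of \<open>u\<close> and \<open>v\<close> a
  genuine solution of \<open>u = h * v\<close>; nonzero \<open>U\<close> keeps \<open>fh\<close>
  away from \<open>f\<close>.\<close>

lemma explicit_is_darboux:
  assumes UV: "\<And>m n. U_fun M N \<rho>1 \<rho>2 k1 k2 p q cp cm m n \<noteq> 0" "\<And>m n. V_fun M N \<rho>1 \<rho>2 k1 k2 p q cp cm m n \<noteq> 0"
  shows "darboux_transform \<mu> \<nu> f (explicit_transform M N \<rho>1 \<rho>2 k1 k2 p q cp cm)"
proof -
  define fh where "fh = explicit_transform M N \<rho>1 \<rho>2 k1 k2 p q cp cm"
  have fh: "fh (m, n) - f (m, n) = u cp cm m n * inverse (v cp cm m n)" for m n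
    using explicit_transform_eq[OF UV(2)] by (simp add: fh_def)
  have nz: "u cp cm m n \<noteq> 0" "v cp cm m n \<noteq> 0" for m n
    using UV by (simp_all add: uv_nonzero)
  have h: "u cp cm m n = (fh (m, n) - f (m, n)) * v cp cm m n" for m n
    using nz by (simp add: fh mult.assoc)
  have "fh (m, n) \<noteq> f (m, n)" for m n
    using h[of m n] nz by auto
  moreover have "darboux_edge (dm m) r1 (fh (m, n) - f (m, n)) (fh (m + 1, n) - f (m + 1, n))" for m n
    by (rule darboux_edge_intro[OF nz(2) uv_step_m h h])
  moreover have "darboux_edge (dn n) r2 (fh (m, n) - f (m, n)) (fh (m, n + 1) - f (m, n + 1))" for m n
    by (rule darboux_edge_intro[OF nz(2) uv_step_n h h])
  ultimately show ?thesis
    by (auto simp: darboux_transform_iff simp flip: fh_def)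
qed

section \<open>Properties of an arbitrary Darboux transform\<close>

context
  fixes fh :: "vertex \<Rightarrow> quat"
  assumes darboux: "darboux_transform \<mu> \<nu> f fh"
begin

lemma darboux_facts: "fh i \<noteq> f i"
    "darboux_edge (dm m) r1 (fh (m, n) - f (m, n)) (fh (m + 1, n) - f (m + 1, n))"
    "darboux_edge (dn n) r2 (fh (m, n) - f (m, n)) (fh (m, n + 1) - f (m, n + 1))"
  using darboux unfolding darboux_transform_iff by blast+

lemma darboux_isothermic: "discrete_isothermic \<mu> fh"
  unfolding discrete_isothermic_iff
proof (intro allI)
  fix m n
  note step = torus_step[symmetric]
  show "cross_ratio (fh (m, n)) (fh (m + 1, n)) (fh (m + 1, n + 1)) (fh (m, n + 1)) = of_real (r1 / r2)"
  proof (rule cross_ratio_darboux_parallelogram)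
    show "darboux_edge (dm m) r1 (fh (m, n) - f (m, n)) (fh (m + 1, n) - (f (m, n) + dm m))"
      "darboux_edge (dn n) r2 (fh (m, n) - f (m, n)) (fh (m, n + 1) - (f (m, n) + dn n))"
      "darboux_edge (dn n) r2 (fh (m + 1, n) - (f (m, n) + dm m)) (fh (m + 1, n + 1) - (f (m, n) + dm m + dn n))"
      unfolding step by (rule darboux_facts)+
    show "darboux_edge (dm m) r1 (fh (m, n + 1) - (f (m, n) + dn n)) (fh (m + 1, n + 1) - (f (m, n) + dm m + dn n))"
      using darboux_facts(2)[of m "n + 1"] by (simp add: torus_step)
    show "fh (m, n) - f (m, n) \<noteq> 0" "fh (m + 1, n) - (f (m, n) + dm m) \<noteq> 0"
      "fh (m + 1, n + 1) - (f (m, n) + dm m + dn n) \<noteq> 0" "fh (m, n + 1) - (f (m, n) + dn n) \<noteq> 0"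
      unfolding step by (simp_all add: darboux_facts)
  qed (use d_nonzero r_bounds d_quotient_square in auto)
qed

lemma darboux_is_explicit:
  "\<exists>cp cm. (\<forall>m n. U_fun M N \<rho>1 \<rho>2 k1 k2 p q cp cm m n \<noteq> 0 \<and>
      V_fun M N \<rho>1 \<rho>2 k1 k2 p q cp cm m n \<noteq> 0) \<and>
    fh = explicit_transform M N \<rho>1 \<rho>2 k1 k2 p q cp cm"
proof -
  define h where "h m n = fh (m, n) - f (m, n)" for m n
  \<comment> \<open>This normalises the homogeneous coordinates at the origin to
    \<open>u = h 0 0\<close> and \<open>v = 1\<close>; the linear steps then carry
    \<open>u = h * v\<close> to every vertex.\<close>
  obtain cp cm where c: "U_fun M N \<rho>1 \<rho>2 k1 k2 p q cp cm 0 0 = (1 / \<kappa>) *\<^sub>R h 0 0"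
      "V_fun M N \<rho>1 \<rho>2 k1 k2 p q cp cm 0 0 = 1"
    using initial_values by blast
  have uv: "u cp cm m n = h m n * v cp cm m n \<and> v cp cm m n \<noteq> 0" for m n
  proof (rule int_lattice_induct[where ?m0.0 = 0 and ?n0.0 = 0])
    show "u cp cm 0 0 = h 0 0 * v cp cm 0 0 \<and> v cp cm 0 0 \<noteq> 0"
      using constant_facts(1) by (simp add: u_def v_def c)
  next
    fix m n
    show "(u cp cm m n = h m n * v cp cm m n \<and> v cp cm m n \<noteq> 0) \<longleftrightarrow>
        (u cp cm (m + 1) n = h (m + 1) n * v cp cm (m + 1) n \<and> v cp cm (m + 1) n \<noteq> 0)"
      unfolding h_def by (rule darboux_edge_transport_iff[OF darboux_facts(2) _ _ _ uv_step_m])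
        (use d_nonzero r_bounds angle_facts in auto)
    show "(u cp cm m n = h m n * v cp cm m n \<and> v cp cm m n \<noteq> 0) \<longleftrightarrow>
        (u cp cm m (n + 1) = h m (n + 1) * v cp cm m (n + 1) \<and> v cp cm m (n + 1) \<noteq> 0)"
      unfolding h_def by (rule darboux_edge_transport_iff[OF darboux_facts(3) _ _ _ uv_step_n])
        (use d_nonzero r_bounds angle_facts in auto)
  qed
  have h0: "h m n \<noteq> 0" for m n
    by (simp add: h_def darboux_facts)
  have V: "V_fun M N \<rho>1 \<rho>2 k1 k2 p q cp cm m n \<noteq> 0" for m n
    using uv uv_nonzero by blast
  have U: "U_fun M N \<rho>1 \<rho>2 k1 k2 p q cp cm m n \<noteq> 0" for m n
  proof -
    have "u cp cm m n \<noteq> 0"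
      using uv[of m n] h0[of m n] by simp
    then show ?thesis
      by (simp add: uv_nonzero)
  qed
  have E: "fh (m, n) = explicit_transform M N \<rho>1 \<rho>2 k1 k2 p q cp cm (m, n)" for m n
  proof -
    have "u cp cm m n * inverse (v cp cm m n) = h m n"
      using uv[of m n] by (simp add: mult.assoc)
    then show ?thesis
      by (simp add: explicit_transform_eq[OF V] h_def)
  qed
  then have "fh = explicit_transform M N \<rho>1 \<rho>2 k1 k2 p q cp cm"
    by (intro ext) (simp only: split_paired_all)
  then show ?thesis
    using U V by (intro exI[of _ cp] exI[of _ cm] conjI allI)
qed

lemma darboux_periodic: "fh (m + \<rho>1 * M, n) = fh (m, n)" "fh (m, n + \<rho>2 * N) = fh (m, n)"
proof -
  obtain cp cm where UV: "\<forall>m n. U_fun M N \<rho>1 \<rho>2 k1 k2 p q cp cm m n \<noteq> 0 \<and>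
      V_fun M N \<rho>1 \<rho>2 k1 k2 p q cp cm m n \<noteq> 0"
    and fh: "fh = explicit_transform M N \<rho>1 \<rho>2 k1 k2 p q cp cm"
    using darboux_is_explicit by (elim exE conjE)
  from UV have V: "V_fun M N \<rho>1 \<rho>2 k1 k2 p q cp cm m n \<noteq> 0" for m n
    by simp
  show "fh (m + \<rho>1 * M, n) = fh (m, n)" "fh (m, n + \<rho>2 * N) = fh (m, n)"
    by (rule explicit_transform_periodic[OF V fh])+
qed

lemma darboux_sphere:
  assumes "norm (fh (m0, n0)) = 1"
  shows "norm (fh (m, n)) = 1"
proof -
  \<comment> \<open>The edge relation can be reversed, so lying on the sphere passes along an edge
    both ways.\<close>
  have *: "norm g = 1 \<longleftrightarrow> norm g' = 1"
    if edge: "darboux_edge (x' - x) r (g - x) (g' - x')" and unit: "norm x = 1" "norm x' = 1" and ne: "x' \<noteq> x" "r \<noteq> 1"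
    for x x' g g' r
  proof
    show "norm g' = 1" if "norm g = 1"
      by (rule darboux_edge_sphere[OF edge unit that ne])
    have "darboux_edge (x - x') r (g' - x') (g - x)"
      using darboux_edge_sym[OF edge] ne by simp
    then show "norm g = 1" if "norm g' = 1"
      using unit(2,1) that ne(1)[symmetric] ne(2) by (rule darboux_edge_sphere)
  qed
  show ?thesis
  proof (rule int_lattice_induct[where P = "\<lambda>m n. norm (fh (m, n)) = 1", OF assms])
    show "norm (fh (m, n)) = 1 \<longleftrightarrow> norm (fh (m + 1, n)) = 1" for m n
      by (rule *[of "f (m + 1, n)" "f (m, n)" r1])
        (use darboux_facts(2)[of m n] r_bounds in \<open>simp_all add: torus_diff torus_regular norm_torus\<close>)
    show "norm (fh (m, n)) = 1 \<longleftrightarrow> norm (fh (m, n + 1)) = 1" for m n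
      by (rule *[of "f (m, n + 1)" "f (m, n)" r2])
        (use darboux_facts(3)[of n m] r_bounds in \<open>simp_all add: torus_diff torus_regular norm_torus\<close>)
  qed
qed

end

end

end

theorem mainTheorem8:
  fixes M N \<rho>1 \<rho>2 k1 k2 :: int and p q \<nu> :: real
    and \<mu> :: "vertex set \<Rightarrow> real" and f :: "vertex \<Rightarrow> quat"
  assumes "M > 2" and "N > 2" and "\<rho>1 > 0" and "\<rho>2 > 0"
    and "cos (k1 * pi / (\<rho>1 * M)) \<noteq> 0" and "tan (k1 * pi / (\<rho>1 * M)) \<noteq> 0"
    and "cos (k2 * pi / (\<rho>2 * N)) \<noteq> 0" and "tan (k2 * pi / (\<rho>2 * N)) \<noteq> 0"
    and "p \<noteq> 0" and "q \<noteq> 0"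
    and "p\<^sup>2 = (1 - (cot (pi / M))\<^sup>2 * (tan (k1 * pi / (\<rho>1 * M)))\<^sup>2) /
      ((cot (pi / N))\<^sup>2 * (tan (k2 * pi / (\<rho>2 * N)))\<^sup>2 -
       (cot (pi / M))\<^sup>2 * (tan (k1 * pi / (\<rho>1 * M)))\<^sup>2)"
    and "q\<^sup>2 = (1 - (cot (pi / N))\<^sup>2 * (tan (k2 * pi / (\<rho>2 * N)))\<^sup>2) /
      ((cot (pi / M))\<^sup>2 * (tan (k1 * pi / (\<rho>1 * M)))\<^sup>2 -
       (cot (pi / N))\<^sup>2 * (tan (k2 * pi / (\<rho>2 * N)))\<^sup>2)"
    and "f = homogeneous_torus M N p q"
    and "\<And>m n. 1 / \<mu> {(m, n), (m + 1, n)} = p\<^sup>2 * (norm (1 - expi (2 * pi / M)))\<^sup>2"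
    and "\<And>m n. 1 / \<mu> {(m, n), (m, n + 1)} = - (q\<^sup>2 * (norm (1 - expi (2 * pi / N)))\<^sup>2)"
    and "\<nu> = 1 / 4 * ((cot (pi / N))\<^sup>2 * (tan (k2 * pi / (\<rho>2 * N)))\<^sup>2 -
       (cot (pi / M))\<^sup>2 * (tan (k1 * pi / (\<rho>1 * M)))\<^sup>2)"
  shows
    "(range f \<subseteq> sphere 0 1 \<and> discrete_isothermic \<mu> f) \<and>
     (\<forall>fh. darboux_transform \<mu> \<nu> f fh \<longrightarrow>
       discrete_isothermic \<mu> fh \<and>
       (\<forall>m n. fh (m + \<rho>1 * M, n) = fh (m, n) \<and> fh (m, n) = fh (m, n + \<rho>2 * N))) \<and>
     (\<forall>fh. darboux_transform \<mu> \<nu> f fh \<longleftrightarrow>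
       (\<exists>cp cm. (\<forall>m n. U_fun M N \<rho>1 \<rho>2 k1 k2 p q cp cm m n \<noteq> 0 \<and>
                       V_fun M N \<rho>1 \<rho>2 k1 k2 p q cp cm m n \<noteq> 0) \<and>
         fh = explicit_transform M N \<rho>1 \<rho>2 k1 k2 p q cp cm)) \<and>
     (\<forall>fh m0 n0. darboux_transform \<mu> \<nu> f fh \<and> fh (m0, n0) \<in> sphere 0 1 \<longrightarrow>
       range fh \<subseteq> sphere 0 1 \<and> discrete_isothermic \<mu> fh \<and>
       (\<forall>m n. fh (m + \<rho>1 * M, n) = fh (m, n) \<and> fh (m, n) = fh (m, n + \<rho>2 * N)))"
proof -
  interpret torus_parameters M N \<rho>1 \<rho>2 k1 k2 p q \<nu>
    by unfold_locales (fact assms)+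
  note f = \<open>f = homogeneous_torus M N p q\<close>
  note \<mu> = assms(14,15)
  have explicit: "\<forall>fh. darboux_transform \<mu> \<nu> f fh \<longleftrightarrow>
       (\<exists>cp cm. (\<forall>m n. U_fun M N \<rho>1 \<rho>2 k1 k2 p q cp cm m n \<noteq> 0 \<and>
                       V_fun M N \<rho>1 \<rho>2 k1 k2 p q cp cm m n \<noteq> 0) \<and>
         fh = explicit_transform M N \<rho>1 \<rho>2 k1 k2 p q cp cm)"
  proof (intro allI iffI)
    fix fh
    assume "darboux_transform \<mu> \<nu> f fh"
    then show "\<exists>cp cm. (\<forall>m n. U_fun M N \<rho>1 \<rho>2 k1 k2 p q cp cm m n \<noteq> 0 \<and>
                       V_fun M N \<rho>1 \<rho>2 k1 k2 p q cp cm m n \<noteq> 0) \<and>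
         fh = explicit_transform M N \<rho>1 \<rho>2 k1 k2 p q cp cm"
      unfolding f by (rule darboux_is_explicit[OF \<mu>])
  next
    fix fh
    assume "\<exists>cp cm. (\<forall>m n. U_fun M N \<rho>1 \<rho>2 k1 k2 p q cp cm m n \<noteq> 0 \<and>
                       V_fun M N \<rho>1 \<rho>2 k1 k2 p q cp cm m n \<noteq> 0) \<and>
         fh = explicit_transform M N \<rho>1 \<rho>2 k1 k2 p q cp cm"
    then obtain cp cm where UV: "\<forall>m n. U_fun M N \<rho>1 \<rho>2 k1 k2 p q cp cm m n \<noteq> 0 \<and>
        V_fun M N \<rho>1 \<rho>2 k1 k2 p q cp cm m n \<noteq> 0"
      and fh: "fh = explicit_transform M N \<rho>1 \<rho>2 k1 k2 p q cp cm"
      by (elim exE conjE)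
    show "darboux_transform \<mu> \<nu> f fh"
      unfolding f fh by (rule explicit_is_darboux[OF \<mu>]; simp add: UV)
  qed
  have torus: "range f \<subseteq> sphere 0 1" "discrete_isothermic \<mu> f"
    unfolding f using norm_torus torus_isothermic[OF \<mu>] by auto
  have isothermic_torus: "discrete_isothermic \<mu> fh \<and>
      (\<forall>m n. fh (m + \<rho>1 * M, n) = fh (m, n) \<and> fh (m, n) = fh (m, n + \<rho>2 * N))"
    if "darboux_transform \<mu> \<nu> f fh" for fh
    using darboux_isothermic[OF \<mu> that[unfolded f]] darboux_periodic[OF \<mu> that[unfolded f]] by simp
  have in_sphere: "range fh \<subseteq> sphere 0 1"
    if "darboux_transform \<mu> \<nu> f fh" and "fh (m0, n0) \<in> sphere 0 1" for fh m0 n0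
    using darboux_sphere[OF \<mu> that(1)[unfolded f], of m0 n0] that(2) by auto
  show ?thesis
  proof (intro conjI torus explicit)
    show "\<forall>fh. darboux_transform \<mu> \<nu> f fh \<longrightarrow> discrete_isothermic \<mu> fh \<and>
       (\<forall>m n. fh (m + \<rho>1 * M, n) = fh (m, n) \<and> fh (m, n) = fh (m, n + \<rho>2 * N))"
      by (intro allI impI) (rule isothermic_torus)
    show "\<forall>fh m0 n0. darboux_transform \<mu> \<nu> f fh \<and> fh (m0, n0) \<in> sphere 0 1 \<longrightarrow>
       range fh \<subseteq> sphere 0 1 \<and> discrete_isothermic \<mu> fh \<and>
       (\<forall>m n. fh (m + \<rho>1 * M, n) = fh (m, n) \<and> fh (m, n) = fh (m, n + \<rho>2 * N))"
      by (intro allI impI, erule conjE, rule conjI, erule (1) in_sphere, erule isothermic_torus)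
  qed
qed

end
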